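(* Let $T$ be a complete theory in a countable continuous language. Then $T$ is $\aleph_0$-stable if and only if $\mathrm{RM}_\varepsilon(X)$ is an ordinal for every non-empty type-definable set $X$ and every $\varepsilon>0$.
   Context: Setting: continuous first order logic. Let $\bar M$ be a monster model of $T$ (very saturated and strongly homogeneous); type-definable sets $X\subseteq\bar M^n$ are those defined by partial types over small parameter sets in $\bar M$. For a parameter set $A$, $\mathrm{S}_n(A)$ is the space of complete $n$-types over $A$ with the logic topology and the standard metric $d(p,q)=\inf\{d(\bar a,\bar b):\bar a\models p,\ \bar b\models q\}$ (realisations in a saturated model, the distance between tuples being the maximum of coordinate distances). $T$ is $\aleph_0$-stable if $(\mathrm{S}_n(A),d)$ has metric density character at most $\aleph_0$ for every $n$ and every countable $A$. For a space $Z$ with a topology and a metric: a set $A\subseteq Z$ is $\varepsilon$-finite if for some $n<\omega$ there are no $a_0,\dots,a_n\in A$ with $d(a_i,a_j)>\varepsilon$ for all $i<j\le n$. $Z'_{f,\varepsilon}$ is $Z$ minus the union of its open $\varepsilon$-finite subsets; $Z^{(0)}_{f,\varepsilon}=Z$, $Z^{(\alpha+1)}_{f,\varepsilon}=(Z^{(\alpha)}_{f,\varepsilon})'_{f,\varepsilon}$ (computed in the subspace), intersections at limits; $\mathrm{CB}^Z_{f,\varepsilon}(A)=\sup\{\alpha:Z^{(\alpha)}_{f,\varepsilon}\cap A\ne\varnothing\}$, equal to $\infty$ if the intersection is non-empty for all ordinals $\alpha$. The $\varepsilon$-Morley rank of $X$ is $\mathrm{RM}_\varepsilon(X)=\mathrm{CB}^{\mathrm{S}_n(\bar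 M)}_{f,\varepsilon}([X])$, where $[X]\subseteq\mathrm{S}_n(\bar M)$ is the closed set of types defined by the partial type defining $X$. *)

theory Defs
  imports "HOL-Analysis.Analysis"
begin

section \<open>Ordinals and ordinal-valued ranks\<close>

text \<open>
  The type \<open>'a ordinal\<close> consists of the order types of well-orders whose field is a set of
  elements of \<open>'a\<close>; these are all the ordinals of cardinality at most that of \<open>'a\<close>.
\<close>

quotient_type 'a ordinal = "'a rel" / partial: "\<lambda>r s :: 'a rel. (r, s) \<in> ordIso"
proof (rule part_equivpI)
  show "\<exists>r :: 'a rel. (r, r) \<in> ordIso"
    using card_of_Well_order ordIso_reflexive by blast
  show "symp (\<lambda>r s :: 'a rel. (r, s) \<in> ordIso)"
    by (auto intro!: sympI ordIso_symmetric)
  show "transp (\<lambda>r s :: 'a rel. (r, s) \<in> ordIso)"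
    by (auto intro!: transpI elim: ordIso_transitive)
qed

instantiation ordinal :: (type) wellorder
begin

lift_definition less_eq_ordinal :: "'a ordinal \<Rightarrow> 'a ordinal \<Rightarrow> bool" is "\<lambda>r s. (r, s) \<in> ordLeq"
  by (meson ordIso_ordLeq_trans ordIso_symmetric ordLeq_ordIso_trans)

lift_definition less_ordinal :: "'a ordinal \<Rightarrow> 'a ordinal \<Rightarrow> bool" is "\<lambda>r s. (r, s) \<in> ordLess"
  by (meson ordIso_ordLess_trans ordIso_symmetric ordLess_ordIso_trans)

instance
proof
  fix x y z :: "'a ordinal"
  show "(x < y) = (x \<le> y \<and> \<not> y \<le> x)"
    by transfer (auto simp: ordIso_def dest: ordLess_imp_ordLeq not_ordLess_ordLeq
        intro: not_ordLeq_iff_ordLess[THEN iffD1])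
  show "x \<le> x"
    by transfer (simp add: ordIso_imp_ordLeq)
  show "x \<le> y \<Longrightarrow> y \<le> z \<Longrightarrow> x \<le> z"
    by transfer (blast intro: ordLeq_transitive)
  show "x \<le> y \<Longrightarrow> y \<le> x \<Longrightarrow> x = y"
    by transfer (simp add: ordIso_iff_ordLeq)
  show "x \<le> y \<or> y \<le> x"
    by transfer (auto simp: ordIso_def dest: ordLeq_total)
next
  fix P :: "'a ordinal \<Rightarrow> bool" and a :: "'a ordinal"
  assume step: "\<And>x. (\<And>y. y < x \<Longrightarrow> P y) \<Longrightarrow> P x"
  have "wfp ((<) :: 'a ordinal \<Rightarrow> 'a ordinal \<Rightarrow> bool)"
  proof -
    have "{(x, y). x < (y :: 'a ordinal)} \<subseteq> inv_image ordLess rep_ordinal"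
      by (auto simp: less_ordinal.rep_eq)
    then show ?thesis
      unfolding wfp_def using wf_subset[OF wf_inv_image[OF wf_ordLess]] by blast
  qed
  then show "P a"
    by (induction a rule: wfp_induct_rule) (rule step)
qed

end

datatype 'o rank = Ordinal 'o | Infinity


section \<open>The Cantor-Bendixson analysis of a space with a topology and a metric\<close>

definition eps_finite :: "('z \<Rightarrow> 'z \<Rightarrow> real) \<Rightarrow> real \<Rightarrow> 'z set \<Rightarrow> bool" where
  "eps_finite d \<epsilon> A \<longleftrightarrow>
     (\<exists>n::nat. \<not> (\<exists>a :: nat \<Rightarrow> 'z. (\<forall>i\<le>n. a i \<in> A) \<and> (\<forall>j\<le>n. \<forall>i<j. d (a i) (a j) > \<epsilon>)))"

definition cb_derivative :: "'z topology \<Rightarrow> ('z \<Rightarrow> 'z \<Rightarrow> real) \<Rightarrow> real \<Rightarrow> 'z set \<Rightarrow> 'z set" where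
  "cb_derivative X d \<epsilon> Z = Z - \<Union>{U. openin (subtopology X Z) U \<and> eps_finite d \<epsilon> U}"

text \<open>
  The three cases are zero, successor and limit; in the second one \<open>GREATEST \<beta>. \<beta> < \<alpha>\<close> is the
  predecessor of \<open>\<alpha>\<close>.
\<close>

function cb_stage ::
  "'z topology \<Rightarrow> ('z \<Rightarrow> 'z \<Rightarrow> real) \<Rightarrow> real \<Rightarrow> 'o::wellorder \<Rightarrow> 'z set" where
  "cb_stage X d \<epsilon> \<alpha> =
     (if \<forall>\<beta>. \<alpha> \<le> \<beta> then topspace X
      else if \<exists>\<beta><\<alpha>. \<forall>\<gamma><\<alpha>. \<gamma> \<le> \<beta> then cb_derivative X d \<epsilon> (cb_stage X d \<epsilon> (GREATEST \<beta>. \<beta> < \<alpha>))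
      else (\<Inter>\<beta>\<in>{..<\<alpha>}. cb_stage X d \<epsilon> \<beta>))"
  by pat_completeness auto
termination
proof (relation "inv_image {(\<beta>, \<alpha>). \<beta> < \<alpha>} (\<lambda>(X, d, \<epsilon>, \<alpha>). \<alpha>)", goal_cases)
  case 1
  show ?case by (intro wf_inv_image wf)
next
  case (2 X d \<epsilon> \<alpha>)
  then obtain \<beta> where "\<beta> < \<alpha>" "\<forall>\<gamma><\<alpha>. \<gamma> \<le> \<beta>" by blast
  then have "(GREATEST \<beta>. \<beta> < \<alpha>) = \<beta>" by (intro Greatest_equality) auto
  with \<open>\<beta> < \<alpha>\<close> show ?case by simp
next
  case 3
  then show ?case by simp
qed

declare cb_stage.simps [simp del]

text \<open>
  The stages decrease, and as long as they do so strictly each one loses a point.  So the sequence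
  becomes constant at an ordinal of cardinality at most that of the space, and quantifying over
  \<open>'z ordinal\<close>, where \<open>'z\<close> is the type of points, amounts to quantifying over all ordinals.  The
  \<open>LEAST\<close> is the supremum of the ordinals whose stage meets \<open>A\<close>.
\<close>

definition CB_rank ::
  "'z topology \<Rightarrow> ('z \<Rightarrow> 'z \<Rightarrow> real) \<Rightarrow> real \<Rightarrow> 'z set \<Rightarrow> 'z ordinal rank" where
  "CB_rank X d \<epsilon> A =
     (if \<forall>\<alpha> :: 'z ordinal. cb_stage X d \<epsilon> \<alpha> \<inter> A \<noteq> {} then Infinity
      else Ordinal (LEAST \<beta>. \<forall>\<alpha>. cb_stage X d \<epsilon> \<alpha> \<inter> A \<noteq> {} \<longrightarrow> \<alpha> \<le> \<beta>))"


section \<open>Continuous first order logic\<close>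

text \<open>
  Truth values lie in the interval from 0 (true) to 1 (false).  Every symbol carries, for each of
  its arguments, a modulus of uniform continuity.
\<close>

record ('f, 'p) signature =
  fun_syms :: "'f set"
  pred_syms :: "'p set"
  fun_arity :: "'f \<Rightarrow> nat"
  pred_arity :: "'p \<Rightarrow> nat"
  fun_modulus :: "'f \<Rightarrow> nat \<Rightarrow> real \<Rightarrow> real"
  pred_modulus :: "'p \<Rightarrow> nat \<Rightarrow> real \<Rightarrow> real"

definition continuous_signature :: "('f, 'p) signature \<Rightarrow> bool" where
  "continuous_signature L \<longleftrightarrow>
     (\<forall>f\<in>fun_syms L. \<forall>i<fun_arity L f. \<forall>\<epsilon>>0. fun_modulus L f i \<epsilon> > 0) \<and>
     (\<forall>P\<in>pred_syms L. \<forall>i<pred_arity L P. \<forall>\<epsilon>>0. pred_modulus L P i \<epsilon> > 0)"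

definition countable_signature :: "('f, 'p) signature \<Rightarrow> bool" where
  "countable_signature L \<longleftrightarrow> countable (fun_syms L) \<and> countable (pred_syms L)"

record ('f, 'p, 'm) cstructure =
  univ :: "'m set"
  mdist :: "'m \<Rightarrow> 'm \<Rightarrow> real"
  fun_int :: "'f \<Rightarrow> 'm list \<Rightarrow> 'm"
  pred_int :: "'p \<Rightarrow> 'm list \<Rightarrow> real"

definition is_structure :: "('f, 'p) signature \<Rightarrow> ('f, 'p, 'm) cstructure \<Rightarrow> bool" where
  "is_structure L M \<longleftrightarrow>
     univ M \<noteq> {} \<and>
     Metric_space (univ M) (mdist M) \<and>
     Metric_space.mcomplete (univ M) (mdist M) \<and>
     (\<forall>a\<in>univ M. \<forall>b\<in>univ M. mdist M a b \<le> 1) \<and>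
     (\<forall>f\<in>fun_syms L. \<forall>as\<in>lists (univ M). length as = fun_arity L f \<longrightarrow>
        fun_int M f as \<in> univ M \<and>
        (\<forall>i<length as. \<forall>b\<in>univ M. \<forall>\<epsilon>>0. mdist M (as ! i) b < fun_modulus L f i \<epsilon> \<longrightarrow>
           mdist M (fun_int M f as) (fun_int M f (as[i := b])) \<le> \<epsilon>)) \<and>
     (\<forall>P\<in>pred_syms L. \<forall>as\<in>lists (univ M). length as = pred_arity L P \<longrightarrow>
        pred_int M P as \<in> {0..1} \<and>
        (\<forall>i<length as. \<forall>b\<in>univ M. \<forall>\<epsilon>>0. mdist M (as ! i) b < pred_modulus L P i \<epsilon> \<longrightarrow>
           \<bar>pred_int M P as - pred_int M P (as[i := b])\<bar> \<le> \<epsilon>))"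

text \<open>
  \<open>Par a\<close> is a constant for the element \<open>a\<close> of a structure: the terms and formulas of the language
  expanded by constants for \<open>A\<close> are those whose parameters are in \<open>A\<close>, and those of the language
  itself have no parameters.
\<close>

datatype ('f, 'm) trm = Var nat | Par 'm | Fn 'f "('f, 'm) trm list"

text \<open>
  The connectives are the usual full system: negation \<open>1 - x\<close>, halving \<open>x / 2\<close> and truncated
  subtraction \<open>max 0 (x - y)\<close>.  Every continuous connective is a uniform limit of combinations of
  these, so that other choices lead to the same types and the same topology on them.
\<close>

datatype ('f, 'p, 'm) fml =
    Dist "('f, 'm) trm" "('f, 'm) trm"
  | Pred 'p "('f, 'm) trm list"
  | Neg "('f, 'p, 'm) fml"
  | Half "('f, 'p, 'm) fml"
  | Minus "('f, 'p, 'm) fml" "('f, 'p, 'm) fml"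
  | QInf nat "('f, 'p, 'm) fml"
  | QSup nat "('f, 'p, 'm) fml"

fun wf_trm :: "('f, 'p) signature \<Rightarrow> 'm set \<Rightarrow> ('f, 'm) trm \<Rightarrow> bool" where
  "wf_trm L A (Var x) \<longleftrightarrow> True"
| "wf_trm L A (Par a) \<longleftrightarrow> a \<in> A"
| "wf_trm L A (Fn f ts) \<longleftrightarrow>
     f \<in> fun_syms L \<and> length ts = fun_arity L f \<and> (\<forall>t\<in>set ts. wf_trm L A t)"

fun fv_trm :: "('f, 'm) trm \<Rightarrow> nat set" where
  "fv_trm (Var x) = {x}"
| "fv_trm (Par a) = {}"
| "fv_trm (Fn f ts) = (\<Union>t\<in>set ts. fv_trm t)"

fun eval_trm :: "('f, 'p, 'm) cstructure \<Rightarrow> (nat \<Rightarrow> 'm) \<Rightarrow> ('f, 'm) trm \<Rightarrow> 'm" where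
  "eval_trm M s (Var x) = s x"
| "eval_trm M s (Par a) = a"
| "eval_trm M s (Fn f ts) = fun_int M f (map (eval_trm M s) ts)"

primrec wf_fml :: "('f, 'p) signature \<Rightarrow> 'm set \<Rightarrow> ('f, 'p, 'm) fml \<Rightarrow> bool" where
  "wf_fml L A (Dist t u) \<longleftrightarrow> wf_trm L A t \<and> wf_trm L A u"
| "wf_fml L A (Pred P ts) \<longleftrightarrow>
     P \<in> pred_syms L \<and> length ts = pred_arity L P \<and> (\<forall>t\<in>set ts. wf_trm L A t)"
| "wf_fml L A (Neg \<phi>) \<longleftrightarrow> wf_fml L A \<phi>"
| "wf_fml L A (Half \<phi>) \<longleftrightarrow> wf_fml L A \<phi>"
| "wf_fml L A (Minus \<phi> \<psi>) \<longleftrightarrow> wf_fml L A \<phi> \<and> wf_fml L A \<psi>"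
| "wf_fml L A (QInf x \<phi>) \<longleftrightarrow> wf_fml L A \<phi>"
| "wf_fml L A (QSup x \<phi>) \<longleftrightarrow> wf_fml L A \<phi>"

primrec fv_fml :: "('f, 'p, 'm) fml \<Rightarrow> nat set" where
  "fv_fml (Dist t u) = fv_trm t \<union> fv_trm u"
| "fv_fml (Pred P ts) = (\<Union>t\<in>set ts. fv_trm t)"
| "fv_fml (Neg \<phi>) = fv_fml \<phi>"
| "fv_fml (Half \<phi>) = fv_fml \<phi>"
| "fv_fml (Minus \<phi> \<psi>) = fv_fml \<phi> \<union> fv_fml \<psi>"
| "fv_fml (QInf x \<phi>) = fv_fml \<phi> - {x}"
| "fv_fml (QSup x \<phi>) = fv_fml \<phi> - {x}"

primrec eval_fml ::
  "('f, 'p, 'm) cstructure \<Rightarrow> (nat \<Rightarrow> 'm) \<Rightarrow> ('f, 'p, 'm) fml \<Rightarrow> real" where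
  "eval_fml M s (Dist t u) = mdist M (eval_trm M s t) (eval_trm M s u)"
| "eval_fml M s (Pred P ts) = pred_int M P (map (eval_trm M s) ts)"
| "eval_fml M s (Neg \<phi>) = 1 - eval_fml M s \<phi>"
| "eval_fml M s (Half \<phi>) = eval_fml M s \<phi> / 2"
| "eval_fml M s (Minus \<phi> \<psi>) = max 0 (eval_fml M s \<phi> - eval_fml M s \<psi>)"
| "eval_fml M s (QInf x \<phi>) = (INF a\<in>univ M. eval_fml M (s(x := a)) \<phi>)"
| "eval_fml M s (QSup x \<phi>) = (SUP a\<in>univ M. eval_fml M (s(x := a)) \<phi>)"

definition formulas :: "('f, 'p) signature \<Rightarrow> nat \<Rightarrow> 'm set \<Rightarrow> ('f, 'p, 'm) fml set" where
  "formulas L n A = {\<phi>. wf_fml L A \<phi> \<and> fv_fml \<phi> \<subseteq> {..<n}}"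

abbreviation sentences :: "('f, 'p) signature \<Rightarrow> ('f, 'p, 'm) fml set" where
  "sentences L \<equiv> formulas L 0 {}"

abbreviation tuples :: "('f, 'p, 'm) cstructure \<Rightarrow> nat \<Rightarrow> (nat \<Rightarrow> 'm) set" where
  "tuples M n \<equiv> {..<n} \<rightarrow>\<^sub>E univ M"

text \<open>A formula \<open>\<phi>\<close> in a theory or in a partial type stands for the condition \<open>\<phi> = 0\<close>.\<close>

definition solutions ::
  "('f, 'p, 'm) cstructure \<Rightarrow> nat \<Rightarrow> ('f, 'p, 'm) fml set \<Rightarrow> (nat \<Rightarrow> 'm) set" where
  "solutions M n \<pi> = {a \<in> tuples M n. \<forall>\<phi>\<in>\<pi>. eval_fml M a \<phi> = 0}"

definition models ::
  "('f, 'p) signature \<Rightarrow> ('f, 'p, 'm) cstructure \<Rightarrow> ('f, 'p, 'm) fml set \<Rightarrow> bool" where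
  "models L M T \<longleftrightarrow> is_structure L M \<and> (\<forall>\<phi>\<in>T. \<forall>s. eval_fml M s \<phi> = 0)"

definition elementarily_equivalent ::
  "('f, 'p) signature \<Rightarrow> ('f, 'p, 'm) cstructure \<Rightarrow> ('f, 'p, 'm) cstructure \<Rightarrow> bool" where
  "elementarily_equivalent L M N \<longleftrightarrow>
     (\<forall>\<phi>\<in>sentences L. \<forall>s t. eval_fml M s \<phi> = eval_fml N t \<phi>)"

text \<open>
  The models considered are those whose universe lies in the type of parameters, that is, the type of
  the monster model in what follows.
\<close>

definition complete_theory :: "('f, 'p) signature \<Rightarrow> ('f, 'p, 'm) fml set \<Rightarrow> bool" where
  "complete_theory L T \<longleftrightarrow>
     T \<subseteq> sentences L \<and> (\<exists>M. models L M T) \<and>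
     (\<forall>M N. models L M T \<longrightarrow> models L N T \<longrightarrow> elementarily_equivalent L M N)"


subsection \<open>Saturation, homogeneity and monster models\<close>

definition elementary_extension ::
  "('f, 'p) signature \<Rightarrow> ('f, 'p, 'm) cstructure \<Rightarrow> ('f, 'p, 'm) cstructure \<Rightarrow> bool" where
  "elementary_extension L M N \<longleftrightarrow>
     is_structure L M \<and> is_structure L N \<and> univ M \<subseteq> univ N \<and>
     (\<forall>n. \<forall>\<phi>\<in>formulas L n {}. \<forall>a\<in>tuples M n. eval_fml M a \<phi> = eval_fml N a \<phi>)"

text \<open>
  Consistency of a set of conditions over \<open>A\<close> with the elementary diagram of \<open>A\<close> in \<open>M\<close>, in the form
  of approximate finite satisfiability in \<open>M\<close>.
\<close>

definition consistent_in ::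
  "('f, 'p, 'm) cstructure \<Rightarrow> nat \<Rightarrow> ('f, 'p, 'm) fml set \<Rightarrow> bool" where
  "consistent_in M n \<pi> \<longleftrightarrow>
     (\<forall>\<pi>\<^sub>0 \<subseteq> \<pi>. finite \<pi>\<^sub>0 \<longrightarrow>
        (\<forall>\<delta>>0. \<exists>a\<in>tuples M n. \<forall>\<phi>\<in>\<pi>\<^sub>0. eval_fml M a \<phi> \<le> \<delta>))"

definition small :: "'k rel \<Rightarrow> 'm set \<Rightarrow> bool" where
  "small \<kappa> A \<longleftrightarrow> (card_of A, \<kappa>) \<in> ordLess"

definition saturated ::
  "('f, 'p) signature \<Rightarrow> 'k rel \<Rightarrow> ('f, 'p, 'm) cstructure \<Rightarrow> bool" where
  "saturated L \<kappa> M \<longleftrightarrow>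
     (\<forall>A n \<pi>. A \<subseteq> univ M \<longrightarrow> small \<kappa> A \<longrightarrow> \<pi> \<subseteq> formulas L n A \<longrightarrow> consistent_in M n \<pi> \<longrightarrow>
        solutions M n \<pi> \<noteq> {})"

definition elementary_map ::
  "('f, 'p) signature \<Rightarrow> ('f, 'p, 'm) cstructure \<Rightarrow> 'm set \<Rightarrow> ('m \<Rightarrow> 'm) \<Rightarrow> bool" where
  "elementary_map L M A g \<longleftrightarrow>
     A \<subseteq> univ M \<and> g ` A \<subseteq> univ M \<and>
     (\<forall>n. \<forall>\<phi>\<in>formulas L n {}. \<forall>a\<in>{..<n} \<rightarrow>\<^sub>E A. eval_fml M (g \<circ> a) \<phi> = eval_fml M a \<phi>)"

definition automorphism ::
  "('f, 'p) signature \<Rightarrow> ('f, 'p, 'm) cstructure \<Rightarrow> ('m \<Rightarrow> 'm) \<Rightarrow> bool" where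
  "automorphism L M h \<longleftrightarrow>
     bij_betw h (univ M) (univ M) \<and>
     (\<forall>a\<in>univ M. \<forall>b\<in>univ M. mdist M (h a) (h b) = mdist M a b) \<and>
     (\<forall>f\<in>fun_syms L. \<forall>as\<in>lists (univ M). length as = fun_arity L f \<longrightarrow>
        h (fun_int M f as) = fun_int M f (map h as)) \<and>
     (\<forall>P\<in>pred_syms L. \<forall>as\<in>lists (univ M). length as = pred_arity L P \<longrightarrow>
        pred_int M P (map h as) = pred_int M P as)"

definition strongly_homogeneous ::
  "('f, 'p) signature \<Rightarrow> 'k rel \<Rightarrow> ('f, 'p, 'm) cstructure \<Rightarrow> bool" where
  "strongly_homogeneous L \<kappa> M \<longleftrightarrow>
     (\<forall>A g. small \<kappa> A \<longrightarrow> elementary_map L M A g \<longrightarrow>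
        (\<exists>h. automorphism L M h \<and> (\<forall>a\<in>A. h a = g a)))"

text \<open>
  How saturated a monster model is depends on the needs at hand.  Here \<open>\<kappa>\<close> may be any uncountable
  cardinal, so that countable parameter sets are small.
\<close>

definition monster_model ::
  "('f, 'p) signature \<Rightarrow> ('f, 'p, 'm) fml set \<Rightarrow> 'k rel \<Rightarrow> ('f, 'p, 'm) cstructure \<Rightarrow> bool" where
  "monster_model L T \<kappa> M \<longleftrightarrow>
     Card_order \<kappa> \<and> (natLeq, \<kappa>) \<in> ordLess \<and>
     models L M T \<and> saturated L \<kappa> M \<and> strongly_homogeneous L \<kappa> M"

text \<open>
  Types over the whole of \<open>M\<close> need not be realised in \<open>M\<close>.  They are realised in an elementary
  extension \<open>N\<close> that is saturated for parameter sets of the cardinality of \<open>M\<close>.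
\<close>

definition saturated_extension ::
  "('f, 'p) signature \<Rightarrow> ('f, 'p, 'm) cstructure \<Rightarrow> ('f, 'p, 'm) cstructure \<Rightarrow> bool" where
  "saturated_extension L M N \<longleftrightarrow>
     elementary_extension L M N \<and> saturated L (cardSuc (card_of (univ M))) N"


subsection \<open>Type spaces\<close>

text \<open>
  The complete type \<open>p\<close> of \<open>a\<close> over \<open>A\<close> is the function sending a formula over \<open>A\<close> to its value at
  \<open>a\<close>.  Below, \<open>N\<close> is a saturated extension of a model containing \<open>A\<close>, so that the complete types
  over \<open>A\<close> are the types of the tuples of \<open>N\<close>.
\<close>

definition type_of ::
  "('f, 'p) signature \<Rightarrow> ('f, 'p, 'm) cstructure \<Rightarrow> nat \<Rightarrow> 'm set \<Rightarrow> (nat \<Rightarrow> 'm) \<Rightarrow>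
    ('f, 'p, 'm) fml \<Rightarrow> real" where
  "type_of L N n A a = (\<lambda>\<phi>\<in>formulas L n A. eval_fml N a \<phi>)"

definition type_space ::
  "('f, 'p) signature \<Rightarrow> ('f, 'p, 'm) cstructure \<Rightarrow> nat \<Rightarrow> 'm set \<Rightarrow>
    (('f, 'p, 'm) fml \<Rightarrow> real) set" where
  "type_space L N n A = type_of L N n A ` tuples N n"

text \<open>The coarsest topology for which \<open>p \<mapsto> p \<phi>\<close> is continuous for every formula \<open>\<phi>\<close> over \<open>A\<close>.\<close>

definition logic_topology ::
  "('f, 'p) signature \<Rightarrow> ('f, 'p, 'm) cstructure \<Rightarrow> nat \<Rightarrow> 'm set \<Rightarrow>
    (('f, 'p, 'm) fml \<Rightarrow> real) topology" where
  "logic_topology L N n A =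
     subtopology (product_topology (\<lambda>_. euclideanreal) (formulas L n A)) (type_space L N n A)"

text \<open>The maximum of the coordinate distances, and 0 for the empty tuple.\<close>

definition tuple_dist ::
  "('f, 'p, 'm) cstructure \<Rightarrow> nat \<Rightarrow> (nat \<Rightarrow> 'm) \<Rightarrow> (nat \<Rightarrow> 'm) \<Rightarrow> real" where
  "tuple_dist N n a b = Max (insert 0 ((\<lambda>i. mdist N (a i) (b i)) ` {..<n}))"

definition type_dist ::
  "('f, 'p) signature \<Rightarrow> ('f, 'p, 'm) cstructure \<Rightarrow> nat \<Rightarrow> 'm set \<Rightarrow>
    (('f, 'p, 'm) fml \<Rightarrow> real) \<Rightarrow> (('f, 'p, 'm) fml \<Rightarrow> real) \<Rightarrow> real" where
  "type_dist L N n A p q =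
     Inf {tuple_dist N n a b | a b. a \<in> tuples N n \<and> b \<in> tuples N n \<and>
            type_of L N n A a = p \<and> type_of L N n A b = q}"

text \<open>
  Stability of the theory of which \<open>M\<close> is a monster model, so that all parameters are in \<open>M\<close>.
\<close>

definition aleph0_stable ::
  "('f, 'p) signature \<Rightarrow> ('f, 'p, 'm) cstructure \<Rightarrow> ('f, 'p, 'm) cstructure \<Rightarrow> bool" where
  "aleph0_stable L M N \<longleftrightarrow>
     (\<forall>n A. A \<subseteq> univ M \<longrightarrow> countable A \<longrightarrow>
        (\<exists>D \<subseteq> type_space L N n A. countable D \<and>
           (\<forall>p\<in>type_space L N n A. \<forall>\<epsilon>>0. \<exists>q\<in>D. type_dist L N n A p q < \<epsilon>)))"

text \<open>
  \<open>type_definable L \<kappa> M n X \<pi>\<close>: the subset \<open>X\<close> of the \<open>n\<close>-th power of \<open>M\<close> is defined by the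
  partial type \<open>\<pi>\<close> over a small set.
\<close>

definition type_definable ::
  "('f, 'p) signature \<Rightarrow> 'k rel \<Rightarrow> ('f, 'p, 'm) cstructure \<Rightarrow> nat \<Rightarrow> (nat \<Rightarrow> 'm) set \<Rightarrow>
    ('f, 'p, 'm) fml set \<Rightarrow> bool" where
  "type_definable L \<kappa> M n X \<pi> \<longleftrightarrow>
     (\<exists>A \<subseteq> univ M. small \<kappa> A \<and> \<pi> \<subseteq> formulas L n A) \<and> X = solutions M n \<pi>"

definition types_satisfying ::
  "('f, 'p) signature \<Rightarrow> ('f, 'p, 'm) cstructure \<Rightarrow> ('f, 'p, 'm) cstructure \<Rightarrow> nat \<Rightarrow>
    ('f, 'p, 'm) fml set \<Rightarrow> (('f, 'p, 'm) fml \<Rightarrow> real) set" where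
  "types_satisfying L M N n \<pi> = {p \<in> type_space L N n (univ M). \<forall>\<phi>\<in>\<pi>. p \<phi> = 0}"

text \<open>
  The \<open>\<epsilon>\<close>-Morley rank of the type-definable set \<open>X\<close> is given in terms of a partial type \<open>\<pi>\<close> defining
  \<open>X\<close>.  As \<open>M\<close> is saturated, \<open>types_satisfying L M N n \<pi>\<close> only depends on \<open>X\<close>.
\<close>

definition Morley_rank ::
  "('f, 'p) signature \<Rightarrow> ('f, 'p, 'm) cstructure \<Rightarrow> ('f, 'p, 'm) cstructure \<Rightarrow> nat \<Rightarrow> real \<Rightarrow>
    ('f, 'p, 'm) fml set \<Rightarrow> (('f, 'p, 'm) fml \<Rightarrow> real) ordinal rank" where
  "Morley_rank L M N n \<epsilon> \<pi> =
     CB_rank (logic_topology L N n (univ M)) (type_dist L N n (univ M)) \<epsilon>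
       (types_satisfying L M N n \<pi>)"

end

theory Submission
  imports Defs
begin

text \<open>
  Both directions compare two properties of the spaces of types.  The rank of a type-definable set is
  infinite iff its set of types over \<open>M\<close> meets a \<^emph>\<open>perfect\<close> set, that is, a closed set without
  non-empty relatively open \<open>\<epsilon>\<close>-finite subsets.  Stability fails iff over some countable set \<open>A\<close> there are uncountably
  many types with pairwise distances bounded from below.  The first equivalence
  (\<open>CB_rank_Infinity_iff\<close>) rests on the fact that the decreasing sequence of derivatives has to
  become constant at an ordinal of the type in which ranks are measured.

  If there is an uncountable \<open>\<epsilon>\<close>-separated set \<open>W\<close> of types over \<open>A\<close>, consider the closed sets of
  types over \<open>M\<close> whose restrictions to \<open>A\<close> exhaust \<open>W\<close> up to countably many points.  By compactness,
  and because the types over \<open>A\<close> form a second countable space (the language is countable), there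
  is a minimal such closed set.  It is perfect: removing a relatively open subset would lose
  uncountably many points of \<open>W\<close>, and lifting separated types to \<open>M\<close> keeps them separated.

  Conversely, let \<open>P\<close> be perfect.  Every neighbourhood of a point of \<open>P\<close> contains two points of \<open>P\<close> at
  distance greater than \<open>\<epsilon>\<close>.  The distance is lower semicontinuous, so these have closed
  neighbourhoods which are still that far apart, and which only involve finitely many parameters.
  Iteration yields a binary tree of such neighbourhoods.  Over the countable set \<open>A\<close> of all
  parameters in the tree, its branches give continuum many types with pairwise distances at least
  \<open>\<epsilon>\<close>, and by the triangle inequality no countable set is dense.

  What remains is the model theory behind these arguments, for a structure \<open>N\<close> that is saturated
  over \<open>A\<close>: compactness of the space of types, lower semicontinuity of the distance, and the triangle
  inequality.  The first two come from one compactness lemma (\<open>realise_pair\<close>): two types are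
  realised at distance at most \<open>r\<close> if all their finite approximations are realised at distances
  arbitrarily little above \<open>r\<close>.  The triangle inequality moreover needs to replace a realisation of
  the middle type by another one, which is done by quantifying over the remaining variables
  (\<open>approximate_transfer\<close>).
\<close>

section \<open>Terms and formulas\<close>

lemma eval_trm_cong: "(\<And>x. x \<in> fv_trm t \<Longrightarrow> s x = s' x) \<Longrightarrow> eval_trm M s t = eval_trm M s' t"
proof (induction t)
  case (Fn f ts)
  then have "map (eval_trm M s) ts = map (eval_trm M s') ts"
    by (intro map_cong) auto
  then show ?case by (simp only: eval_trm.simps)
qed auto

lemma eval_fml_cong:
  "(\<And>x. x \<in> fv_fml \<phi> \<Longrightarrow> s x = s' x) \<Longrightarrow> eval_fml M s \<phi> = eval_fml M s' \<phi>"
proof (induction \<phi> arbitrary: s s')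
  case (Dist t u)
  then show ?case using eval_trm_cong[of t s s' M] eval_trm_cong[of u s s' M] by simp
next
  case (Pred P ts)
  have "map (eval_trm M s) ts = map (eval_trm M s') ts"
    using Pred by (intro map_cong refl eval_trm_cong) auto
  then show ?case by (simp only: eval_fml.simps)
next
  case (Neg \<phi>)
  have "eval_fml M s \<phi> = eval_fml M s' \<phi>"
    using Neg.prems by (auto intro!: Neg.IH)
  then show ?case by simp
next
  case (Half \<phi>)
  have "eval_fml M s \<phi> = eval_fml M s' \<phi>"
    using Half.prems by (auto intro!: Half.IH)
  then show ?case by simp
next
  case (Minus \<phi> \<psi>)
  have "eval_fml M s \<phi> = eval_fml M s' \<phi>" "eval_fml M s \<psi> = eval_fml M s' \<psi>"
    using Minus.prems by (auto intro!: Minus.IH)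
  then show ?case by simp
next
  case (QInf x \<phi>)
  have "eval_fml M (s(x := a)) \<phi> = eval_fml M (s'(x := a)) \<phi>" for a
    using QInf.prems by (auto intro!: QInf.IH)
  then show ?case by simp
next
  case (QSup x \<phi>)
  have "eval_fml M (s(x := a)) \<phi> = eval_fml M (s'(x := a)) \<phi>" for a
    using QSup.prems by (auto intro!: QSup.IH)
  then show ?case by simp
qed

lemma wf_trm_mono: "wf_trm L A t \<Longrightarrow> A \<subseteq> B \<Longrightarrow> wf_trm L B t"
  by (induction t) auto

lemma wf_fml_mono: "wf_fml L A \<phi> \<Longrightarrow> A \<subseteq> B \<Longrightarrow> wf_fml L B \<phi>"
  by (induction \<phi>) (auto intro: wf_trm_mono)

lemma formulas_mono: "m \<le> n \<Longrightarrow> A \<subseteq> B \<Longrightarrow> formulas L m A \<subseteq> formulas L n B"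
  unfolding formulas_def by (auto intro: wf_fml_mono)

lemma term_support: "wf_trm L A t \<Longrightarrow> \<exists>A\<^sub>0\<subseteq>A. finite A\<^sub>0 \<and> wf_trm L A\<^sub>0 t"
proof (induction t)
  case (Var x)
  then show ?case by (intro exI[of _ "{}"]) auto
next
  case (Par a)
  then show ?case by (intro exI[of _ "{a}"]) auto
next
  case (Fn f ts)
  then have "\<forall>t\<in>set ts. \<exists>A\<^sub>0\<subseteq>A. finite A\<^sub>0 \<and> wf_trm L A\<^sub>0 t" by auto
  then obtain S where S: "\<forall>t\<in>set ts. S t \<subseteq> A \<and> finite (S t) \<and> wf_trm L (S t) t"
    by metis
  then have "\<forall>t\<in>set ts. wf_trm L (\<Union>t\<in>set ts. S t) t"
    by (meson UN_upper wf_trm_mono)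
  then show ?case using S Fn.prems by (intro exI[of _ "\<Union>t\<in>set ts. S t"]) auto
qed

lemma formula_support: "wf_fml L A \<phi> \<Longrightarrow> \<exists>A\<^sub>0\<subseteq>A. finite A\<^sub>0 \<and> wf_fml L A\<^sub>0 \<phi>"
proof (induction \<phi>)
  case (Dist t u)
  then obtain B C where BC: "B \<subseteq> A" "finite B" "wf_trm L B t" "C \<subseteq> A" "finite C" "wf_trm L C u"
    using term_support[of L A t] term_support[of L A u] by auto
  then have "wf_trm L (B \<union> C) t" "wf_trm L (B \<union> C) u"
    by (auto elim: wf_trm_mono)
  with BC show ?case by (intro exI[of _ "B \<union> C"]) simp
next
  case (Pred P ts)
  then have "\<forall>t\<in>set ts. \<exists>A\<^sub>0\<subseteq>A. finite A\<^sub>0 \<and> wf_trm L A\<^sub>0 t"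
    by (simp add: term_support)
  then obtain S where S: "\<forall>t\<in>set ts. S t \<subseteq> A \<and> finite (S t) \<and> wf_trm L (S t) t"
    by metis
  then have "\<forall>t\<in>set ts. wf_trm L (\<Union>t\<in>set ts. S t) t"
    by (meson UN_upper wf_trm_mono)
  then show ?case using S Pred.prems by (intro exI[of _ "\<Union>t\<in>set ts. S t"]) auto
next
  case (Minus \<phi> \<psi>)
  then obtain B C where BC: "B \<subseteq> A" "finite B" "wf_fml L B \<phi>" "C \<subseteq> A" "finite C" "wf_fml L C \<psi>"
    by auto
  then have "wf_fml L (B \<union> C) \<phi>" "wf_fml L (B \<union> C) \<psi>"
    by (auto elim: wf_fml_mono)
  with BC show ?case by (intro exI[of _ "B \<union> C"]) simp
qed auto

lemma formulas_support:
  assumes "finite F" "F \<subseteq> formulas L n A"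
  shows "\<exists>A\<^sub>0\<subseteq>A. finite A\<^sub>0 \<and> F \<subseteq> formulas L n A\<^sub>0"
proof -
  have "\<forall>\<phi>\<in>F. \<exists>A\<^sub>0\<subseteq>A. finite A\<^sub>0 \<and> \<phi> \<in> formulas L n A\<^sub>0"
  proof
    fix \<phi> assume "\<phi> \<in> F"
    then have "wf_fml L A \<phi>" "fv_fml \<phi> \<subseteq> {..<n}"
      using assms unfolding formulas_def by auto
    then show "\<exists>A\<^sub>0\<subseteq>A. finite A\<^sub>0 \<and> \<phi> \<in> formulas L n A\<^sub>0"
      using formula_support[of L A \<phi>] unfolding formulas_def by auto
  qed
  then obtain S where S: "\<forall>\<phi>\<in>F. S \<phi> \<subseteq> A \<and> finite (S \<phi>) \<and> \<phi> \<in> formulas L n (S \<phi>)"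
    by metis
  have "F \<subseteq> formulas L n (\<Union>\<phi>\<in>F. S \<phi>)"
  proof
    fix \<phi> assume "\<phi> \<in> F"
    then show "\<phi> \<in> formulas L n (\<Union>\<phi>\<in>F. S \<phi>)"
      using S formulas_mono[of n n "S \<phi>" "\<Union>\<phi>\<in>F. S \<phi>" L] by auto
  qed
  then show ?thesis using S assms by (intro exI[of _ "\<Union>\<phi>\<in>F. S \<phi>"]) auto
qed

instance trm :: (countable, countable) countable
  by countable_datatype

instance fml :: (countable, countable, countable) countable
  by countable_datatype

lemma wf_trm_symbols: "wf_trm L A t \<Longrightarrow> set1_trm t \<subseteq> fun_syms L \<and> set2_trm t \<subseteq> A"
  by (induction t) auto

lemma wf_fml_symbols:
  "wf_fml L A \<phi> \<Longrightarrow> set1_fml \<phi> \<subseteq> fun_syms L \<and> set2_fml \<phi> \<subseteq> pred_syms L \<and> set3_fml \<phi> \<subseteq> A"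
proof (induction \<phi>)
  case (Dist t u)
  then show ?case using wf_trm_symbols[of L A t] wf_trm_symbols[of L A u] by simp
next
  case (Pred P ts)
  have "set1_trm t \<subseteq> fun_syms L \<and> set2_trm t \<subseteq> A" if "t \<in> set ts" for t
    using Pred that wf_trm_symbols[of L A t] by simp
  then show ?case using Pred by (simp add: UN_subset_iff)
qed auto

text \<open>
  Symbols and parameters can be renamed injectively to natural numbers, and there are only
  countably many formulas with natural numbers as symbols.
\<close>

lemma countable_formulas:
  assumes "countable_signature L" "countable A"
  shows "countable (formulas L n A)"
proof -
  obtain f :: "_ \<Rightarrow> nat" where f: "inj_on f (fun_syms L)"
    using assms countable_signature_def by blast
  obtain p :: "_ \<Rightarrow> nat" where p: "inj_on p (pred_syms L)"
    using assms countable_signature_def by blast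
  obtain c :: "_ \<Rightarrow> nat" where c: "inj_on c A"
    using assms by blast
  have "inj_on (map_fml f p c) (formulas L n A)"
  proof (rule inj_onI)
    fix \<phi> \<psi> assume \<phi>: "\<phi> \<in> formulas L n A" and \<psi>: "\<psi> \<in> formulas L n A"
      and eq: "map_fml f p c \<phi> = map_fml f p c \<psi>"
    have "set1_fml \<phi> \<subseteq> fun_syms L \<and> set2_fml \<phi> \<subseteq> pred_syms L \<and> set3_fml \<phi> \<subseteq> A"
      "set1_fml \<psi> \<subseteq> fun_syms L \<and> set2_fml \<psi> \<subseteq> pred_syms L \<and> set3_fml \<psi> \<subseteq> A"
      using \<phi> \<psi> wf_fml_symbols unfolding formulas_def by blast+
    then show "\<phi> = \<psi>"
      using f p c by (intro fml.inj_map_strong[OF _ _ _ eq]) (auto dest: inj_onD)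
  qed
  then show ?thesis
    by (rule countableI')
qed

text \<open>
  Shifting the bound variables together with the free ones makes the capture of variables
  impossible.
\<close>

fun shift_trm :: "nat \<Rightarrow> ('f, 'm) trm \<Rightarrow> ('f, 'm) trm" where
  "shift_trm k (Var x) = Var (x + k)"
| "shift_trm k (Par a) = Par a"
| "shift_trm k (Fn f ts) = Fn f (map (shift_trm k) ts)"

primrec shift_fml :: "nat \<Rightarrow> ('f, 'p, 'm) fml \<Rightarrow> ('f, 'p, 'm) fml" where
  "shift_fml k (Dist t u) = Dist (shift_trm k t) (shift_trm k u)"
| "shift_fml k (Pred P ts) = Pred P (map (shift_trm k) ts)"
| "shift_fml k (Neg \<phi>) = Neg (shift_fml k \<phi>)"
| "shift_fml k (Half \<phi>) = Half (shift_fml k \<phi>)"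
| "shift_fml k (Minus \<phi> \<psi>) = Minus (shift_fml k \<phi>) (shift_fml k \<psi>)"
| "shift_fml k (QInf x \<phi>) = QInf (x + k) (shift_fml k \<phi>)"
| "shift_fml k (QSup x \<phi>) = QSup (x + k) (shift_fml k \<phi>)"

lemma eval_shift_trm: "eval_trm M s (shift_trm k t) = eval_trm M (\<lambda>i. s (i + k)) t"
proof (induction t)
  case (Fn f ts)
  then have "map (eval_trm M s \<circ> shift_trm k) ts = map (eval_trm M (\<lambda>i. s (i + k))) ts"
    by (intro map_cong) auto
  then show ?case by (simp only: eval_trm.simps shift_trm.simps map_map)
qed auto

lemma eval_shift_fml: "eval_fml M s (shift_fml k \<phi>) = eval_fml M (\<lambda>i. s (i + k)) \<phi>"
proof (induction \<phi> arbitrary: s)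
  case (Pred P ts)
  have "map (eval_trm M s \<circ> shift_trm k) ts = map (eval_trm M (\<lambda>i. s (i + k))) ts"
    by (simp add: eval_shift_trm)
  then show ?case by (simp only: eval_fml.simps shift_fml.simps map_map)
next
  case (QInf x \<phi>)
  have "(\<lambda>i. (s(x + k := a)) (i + k)) = (\<lambda>i. s (i + k))(x := a)" for a by auto
  then show ?case using QInf by simp
next
  case (QSup x \<phi>)
  have "(\<lambda>i. (s(x + k := a)) (i + k)) = (\<lambda>i. s (i + k))(x := a)" for a by auto
  then show ?case using QSup by simp
qed (auto simp: eval_shift_trm)

lemma fv_shift_trm: "fv_trm (shift_trm k t) = (\<lambda>i. i + k) ` fv_trm t"
  by (induction t) auto

lemma fv_shift_fml: "fv_fml (shift_fml k \<phi>) = (\<lambda>i. i + k) ` fv_fml \<phi>"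
  by (induction \<phi>) (auto simp: fv_shift_trm image_Un image_UN image_set_diff)

lemma wf_shift_trm: "wf_trm L A (shift_trm k t) = wf_trm L A t"
  by (induction t) auto

lemma wf_shift_fml: "wf_fml L A (shift_fml k \<phi>) = wf_fml L A \<phi>"
  by (induction \<phi>) (auto simp: wf_shift_trm)

lemma shift_formulas: "\<phi> \<in> formulas L n A \<Longrightarrow> shift_fml k \<phi> \<in> formulas L (n + k) A"
  unfolding formulas_def by (auto simp: wf_shift_fml fv_shift_fml)

lemma eval_formulas_cong:
  "\<phi> \<in> formulas L n A \<Longrightarrow> (\<And>i. i < n \<Longrightarrow> s i = s' i) \<Longrightarrow> eval_fml M s \<phi> = eval_fml M s' \<phi>"
  unfolding formulas_def by (auto intro: eval_fml_cong)

lemma Neg_formulas [simp]: "Neg \<phi> \<in> formulas L n A \<longleftrightarrow> \<phi> \<in> formulas L n A"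
  by (simp add: formulas_def)

lemma Half_formulas [simp]: "Half \<phi> \<in> formulas L n A \<longleftrightarrow> \<phi> \<in> formulas L n A"
  by (simp add: formulas_def)

lemma Minus_formulas [simp]:
  "Minus \<phi> \<psi> \<in> formulas L n A \<longleftrightarrow> \<phi> \<in> formulas L n A \<and> \<psi> \<in> formulas L n A"
  by (auto simp add: formulas_def)

lemma QInf_formulas: "\<phi> \<in> formulas L (Suc n) A \<Longrightarrow> QInf n \<phi> \<in> formulas L n A"
  by (auto simp: formulas_def less_Suc_eq)

section \<open>Definable operations on formulas\<close>

locale structure_with_parameters =
  fixes L :: "('f, 'p) signature"
    and N :: "('f, 'p, 'm) cstructure"
    and A :: "'m set"
  assumes is_structure: "is_structure L N"
    and parameters: "A \<subseteq> univ N"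
begin

lemma univ_nonempty: "univ N \<noteq> {}"
  using is_structure by (simp add: is_structure_def)

sublocale Metric_space "univ N" "mdist N"
  using is_structure by (simp add: is_structure_def)

lemma mdist_le_1: "a \<in> univ N \<Longrightarrow> b \<in> univ N \<Longrightarrow> mdist N a b \<le> 1"
  using is_structure by (simp add: is_structure_def)

lemma fun_int_closed:
  "f \<in> fun_syms L \<Longrightarrow> as \<in> lists (univ N) \<Longrightarrow> length as = fun_arity L f \<Longrightarrow> fun_int N f as \<in> univ N"
  using is_structure by (simp add: is_structure_def)

lemma pred_int_bounds:
  "P \<in> pred_syms L \<Longrightarrow> as \<in> lists (univ N) \<Longrightarrow> length as = pred_arity L P \<Longrightarrow> pred_int N P as \<in> {0..1}"
  using is_structure by (simp add: is_structure_def)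

lemma eval_trm_in_univ:
  "wf_trm L A t \<Longrightarrow> (\<And>x. x \<in> fv_trm t \<Longrightarrow> s x \<in> univ N) \<Longrightarrow> eval_trm N s t \<in> univ N"
proof (induction t)
  case (Fn f ts)
  have "eval_trm N s t \<in> univ N" if "t \<in> set ts" for t
    using Fn.prems that by (intro Fn.IH) auto
  then have "map (eval_trm N s) ts \<in> lists (univ N)" by auto
  then show ?case using Fn.prems by (simp add: fun_int_closed del: in_lists_conv_set)
qed (use parameters in auto)

lemma INF_bounds:
  fixes f :: "'m \<Rightarrow> real"
  assumes "\<And>a. a \<in> univ N \<Longrightarrow> f a \<in> {0..1}"
  shows "(INF a\<in>univ N. f a) \<in> {0..1}" "a \<in> univ N \<Longrightarrow> (INF a\<in>univ N. f a) \<le> f a"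
proof -
  have bdd: "bdd_below (f ` univ N)" using assms by (auto intro!: bdd_belowI[of _ 0])
  show *: "a \<in> univ N \<Longrightarrow> (INF a\<in>univ N. f a) \<le> f a" for a
    using bdd by (rule cINF_lower)
  obtain b where "b \<in> univ N" using univ_nonempty by auto
  with *[of b] assms have "(INF a\<in>univ N. f a) \<le> 1" by force
  moreover have "0 \<le> (INF a\<in>univ N. f a)"
    using assms univ_nonempty by (intro cINF_greatest) auto
  ultimately show "(INF a\<in>univ N. f a) \<in> {0..1}" by simp
qed

lemma SUP_bounds:
  fixes f :: "'m \<Rightarrow> real"
  assumes "\<And>a. a \<in> univ N \<Longrightarrow> f a \<in> {0..1}"
  shows "(SUP a\<in>univ N. f a) \<in> {0..1}"
proof -
  have bdd: "bdd_above (f ` univ N)" using assms by (auto intro!: bdd_aboveI[of _ 1])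
  obtain b where b: "b \<in> univ N" using univ_nonempty by auto
  have "0 \<le> f b" using assms[OF b] by simp
  also have "\<dots> \<le> (SUP a\<in>univ N. f a)" using bdd b by (intro cSUP_upper)
  finally show ?thesis using assms univ_nonempty by (auto intro!: cSUP_least)
qed

lemma eval_fml_bounds:
  "wf_fml L A \<phi> \<Longrightarrow> (\<And>x. x \<in> fv_fml \<phi> \<Longrightarrow> s x \<in> univ N) \<Longrightarrow> eval_fml N s \<phi> \<in> {0..1}"
proof (induction \<phi> arbitrary: s)
  case (Dist t u)
  then show ?case
    using eval_trm_in_univ[of t s] eval_trm_in_univ[of u s] by (simp add: mdist_le_1)
next
  case (Pred P ts)
  have "eval_trm N s t \<in> univ N" if "t \<in> set ts" for t
    using Pred.prems that by (intro eval_trm_in_univ) auto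
  then have "map (eval_trm N s) ts \<in> lists (univ N)" by auto
  then show ?case
    using Pred.prems pred_int_bounds[of P "map (eval_trm N s) ts"] by simp
next
  case (Neg \<phi>)
  then have "eval_fml N s \<phi> \<in> {0..1}" by simp
  then show ?case by simp
next
  case (Half \<phi>)
  then have "eval_fml N s \<phi> \<in> {0..1}" by simp
  then show ?case by simp
next
  case (Minus \<phi> \<psi>)
  have "eval_fml N s \<phi> \<in> {0..1}" "eval_fml N s \<psi> \<in> {0..1}"
    using Minus.prems Minus.IH[of s] by simp_all
  then show ?case by auto
next
  case (QInf x \<phi>)
  have "eval_fml N (s(x := a)) \<phi> \<in> {0..1}" if "a \<in> univ N" for a
    using QInf.prems that by (intro QInf.IH) auto
  then show ?case using INF_bounds(1)[of "\<lambda>a. eval_fml N (s(x := a)) \<phi>"] by simp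
next
  case (QSup x \<phi>)
  have "eval_fml N (s(x := a)) \<phi> \<in> {0..1}" if "a \<in> univ N" for a
    using QSup.prems that by (intro QSup.IH) auto
  then show ?case using SUP_bounds[of "\<lambda>a. eval_fml N (s(x := a)) \<phi>"] by simp
qed

lemma eval_bounds:
  assumes "\<phi> \<in> formulas L n A" "s \<in> {..<n} \<rightarrow> univ N"
  shows "0 \<le> eval_fml N s \<phi>" "eval_fml N s \<phi> \<le> 1"
  using assms eval_fml_bounds[of \<phi> s] unfolding formulas_def by auto

text \<open>
  Halving and negation lead from the numbers with denominator \<open>2 ^ m\<close> to those with denominator
  \<open>2 ^ Suc m\<close>: those up to one half are halves, and negation reflects them in one half.  These
  sentences serve as the constants against which values of formulas are compared.
\<close>

lemma dyadic_sentence: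
  "k \<le> 2 ^ m \<Longrightarrow> \<exists>c\<in>formulas L 0 A. \<forall>s. eval_fml N s c = real k / 2 ^ m"
proof (induction m arbitrary: k)
  case 0
  \<comment> \<open>There are no atomic sentences without symbols, so that a quantifier is needed for zero.\<close>
  define z :: "('f, 'p, 'm) fml" where "z = QInf 0 (Dist (Var 0) (Var 0))"
  have "z \<in> formulas L 0 A" by (auto simp: z_def formulas_def)
  moreover have "eval_fml N s z = 0" for s
  proof -
    have "(INF a\<in>univ N. mdist N a a) = (INF a\<in>univ N. 0)"
      by (intro INF_cong) (auto simp: mdist_zero)
    then show ?thesis using univ_nonempty by (simp add: z_def)
  qed
  moreover from 0 have "k = 0 \<or> k = 1" by auto
  ultimately show ?case
    by (auto intro: bexI[of _ z] bexI[of _ "Neg z"])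
next
  case (Suc m)
  show ?case
  proof (cases "k \<le> 2 ^ m")
    case True
    then obtain c where c: "c \<in> formulas L 0 A" "\<forall>s. eval_fml N s c = real k / 2 ^ m"
      using Suc.IH by blast
    then show ?thesis by (intro bexI[of _ "Half c"]) auto
  next
    case False
    then have "2 ^ Suc m - k \<le> 2 ^ m" by simp
    then obtain c where c: "c \<in> formulas L 0 A" "\<forall>s. eval_fml N s c = real (2 ^ Suc m - k) / 2 ^ m"
      using Suc.IH by blast
    have "real (2 ^ Suc m - k) = 2 ^ Suc m - real k"
      using Suc.prems by (simp add: of_nat_diff)
    then show ?thesis using c
      by (intro bexI[of _ "Neg (Half c)"]) (auto simp: field_simps)
  qed
qed

lemma sentence_between:
  assumes "0 \<le> u" "u \<le> 1" "u < v"
  shows "\<exists>c\<in>formulas L 0 A. \<exists>q. (\<forall>s. eval_fml N s c = q) \<and> u \<le> q \<and> q < v"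
proof -
  obtain m where m: "(1 / 2) ^ m < v - u"
    using real_arch_pow_inv[of "v - u" "1 / 2"] assms by auto
  define k where "k = nat \<lceil>u * 2 ^ m\<rceil>"
  have k: "u * 2 ^ m \<le> real k" "real k < u * 2 ^ m + 1"
    using assms by (auto simp: k_def) linarith+
  have "u * 2 ^ m \<le> 2 ^ m" using assms by simp
  then have "real k < 2 ^ m + 1" using k by linarith
  then have "k \<le> 2 ^ m"
    using of_nat_less_iff[of k "2 ^ m + 1", where ?'a = real] by simp
  then obtain c where c: "c \<in> formulas L 0 A" "\<forall>s. eval_fml N s c = real k / 2 ^ m"
    using dyadic_sentence by blast
  moreover have "u \<le> real k / 2 ^ m" using k by (simp add: field_simps)
  moreover have "real k / 2 ^ m < v"
  proof -
    have "real k / 2 ^ m < u + (1 / 2) ^ m" using k by (simp add: field_simps)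
    then show ?thesis using m by simp
  qed
  ultimately show ?thesis by blast
qed

lemma sentence_below:
  assumes "0 \<le> u" "u \<le> 1" "v < u"
  shows "\<exists>c\<in>formulas L 0 A. \<exists>q. (\<forall>s. eval_fml N s c = q) \<and> v < q \<and> q \<le> u"
proof -
  have "0 \<le> 1 - u" "1 - u \<le> 1" "1 - u < 1 - v" using assms by auto
  from sentence_between[OF this] obtain c q where
    "c \<in> formulas L 0 A" "\<forall>s. eval_fml N s c = q" "1 - u \<le> q" "q < 1 - v" by blast
  then show ?thesis by (intro bexI[of _ "Neg c"] exI[of _ "1 - q"]) auto
qed

lemma sentence_formulas: "c \<in> formulas L 0 A \<Longrightarrow> c \<in> formulas L n A"
  using formulas_mono[of 0 n A A] by blast

text \<open>The maximum is \<open>max x y = 1 - ((1 - x) - max 0 (y - x))\<close> on the unit interval.\<close>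

lemma maximum_formula:
  assumes "finite F" "F \<subseteq> formulas L n A"
  shows "\<exists>\<xi>\<in>formulas L n A. \<forall>s\<in>{..<n} \<rightarrow> univ N. \<forall>r\<ge>0.
           eval_fml N s \<xi> \<le> r \<longleftrightarrow> (\<forall>\<phi>\<in>F. eval_fml N s \<phi> \<le> r)"
  using assms
proof (induction F)
  case empty
  obtain c where "c \<in> formulas L 0 A" "\<forall>s. eval_fml N s c = 0"
    using dyadic_sentence[of 0 0] by auto
  then show ?case using sentence_formulas by (intro bexI[of _ c]) auto
next
  case (insert \<phi> F)
  then obtain \<xi> where \<xi>: "\<xi> \<in> formulas L n A" "\<And>s r. s \<in> {..<n} \<rightarrow> univ N \<Longrightarrow> r \<ge> 0 \<Longrightarrow>
           eval_fml N s \<xi> \<le> r \<longleftrightarrow> (\<forall>\<phi>\<in>F. eval_fml N s \<phi> \<le> r)"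
    by auto
  let ?\<mu> = "Neg (Minus (Neg \<phi>) (Minus \<xi> \<phi>))"
  have "eval_fml N s ?\<mu> \<le> r \<longleftrightarrow> (\<forall>\<psi>\<in>insert \<phi> F. eval_fml N s \<psi> \<le> r)"
    if s: "s \<in> {..<n} \<rightarrow> univ N" and r: "r \<ge> 0" for s r
  proof -
    have "eval_fml N s ?\<mu> = max (eval_fml N s \<phi>) (eval_fml N s \<xi>)"
      using eval_bounds[of \<phi> n s] eval_bounds[of \<xi> n s] insert.prems \<xi> s
      by (auto simp: max_def)
    then show ?thesis using \<xi>(2)[OF s r] by simp
  qed
  then show ?case using \<xi> insert.prems by (intro bexI[of _ ?\<mu>]) auto
qed

text \<open>
  As an infimum need not be attained, its witnesses only come close to it.
\<close>

lemma block_infimum_formula: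
  "\<theta> \<in> formulas L (n + k) A \<Longrightarrow> \<exists>\<xi>\<in>formulas L n A. \<forall>s\<in>{..<n} \<rightarrow> univ N.
     (\<forall>t\<in>{..<n + k} \<rightarrow> univ N. (\<forall>i<n. t i = s i) \<longrightarrow> eval_fml N s \<xi> \<le> eval_fml N t \<theta>) \<and>
     (\<forall>r > eval_fml N s \<xi>. \<exists>t\<in>{..<n + k} \<rightarrow> univ N. (\<forall>i<n. t i = s i) \<and> eval_fml N t \<theta> < r)"
proof (induction k arbitrary: \<theta>)
  case 0
  have eq: "eval_fml N s \<theta> = eval_fml N t \<theta>" if "\<forall>i<n. t i = s i" for s t
    using 0 that eval_formulas_cong[of \<theta> L n A s t N] by simp
  show ?case
  proof (intro bexI[of _ \<theta>] ballI conjI allI impI)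
    show "\<theta> \<in> formulas L n A" using 0 by simp
    show "eval_fml N s \<theta> \<le> eval_fml N t \<theta>" if "\<forall>i<n. t i = s i" for s t
      using eq[OF that] by simp
    show "\<exists>t\<in>{..<n + 0} \<rightarrow> univ N. (\<forall>i<n. t i = s i) \<and> eval_fml N t \<theta> < r"
      if "s \<in> {..<n} \<rightarrow> univ N" "eval_fml N s \<theta> < r" for s r
      using that by (intro bexI[of _ s]) auto
  qed
next
  case (Suc k)
  let ?\<theta> = "QInf (n + k) \<theta>"
  have val: "eval_fml N (t(n + k := a)) \<theta> \<in> {0..1}"
    if "t \<in> {..<n + k} \<rightarrow> univ N" "a \<in> univ N" for t a
    using eval_bounds[of \<theta> "n + Suc k" "t(n + k := a)"] Suc.prems that by (auto simp: Pi_def)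
  obtain \<xi> where \<xi>: "\<xi> \<in> formulas L n A" and
    lower: "\<And>s t. s \<in> {..<n} \<rightarrow> univ N \<Longrightarrow> t \<in> {..<n + k} \<rightarrow> univ N \<Longrightarrow> \<forall>i<n. t i = s i \<Longrightarrow>
      eval_fml N s \<xi> \<le> eval_fml N t ?\<theta>" and
    witness: "\<And>s r. s \<in> {..<n} \<rightarrow> univ N \<Longrightarrow> r > eval_fml N s \<xi> \<Longrightarrow>
      \<exists>t\<in>{..<n + k} \<rightarrow> univ N. (\<forall>i<n. t i = s i) \<and> eval_fml N t ?\<theta> < r"
    using Suc.IH[of ?\<theta>] QInf_formulas[of \<theta> L "n + k" A] Suc.prems by auto
  show ?case
  proof (intro bexI[OF _ \<xi>] ballI conjI allI impI)
    fix s t assume s: "s \<in> {..<n} \<rightarrow> univ N" and t: "t \<in> {..<n + Suc k} \<rightarrow> univ N"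
      and eq: "\<forall>i<n. t i = s i"
    have t': "t \<in> {..<n + k} \<rightarrow> univ N" "t (n + k) \<in> univ N" using t by auto
    have "eval_fml N s \<xi> \<le> eval_fml N t ?\<theta>" using lower[OF s t'(1) eq] .
    also have "\<dots> \<le> eval_fml N (t(n + k := t (n + k))) \<theta>"
      unfolding eval_fml.simps using val[OF t'(1)] t'(2)
      by (rule INF_bounds(2)[where f = "\<lambda>a. eval_fml N (t(n + k := a)) \<theta>"])
    finally show "eval_fml N s \<xi> \<le> eval_fml N t \<theta>" by simp
  next
    fix s r assume s: "s \<in> {..<n} \<rightarrow> univ N" and r: "eval_fml N s \<xi> < r"
    then obtain t where t: "t \<in> {..<n + k} \<rightarrow> univ N" "\<forall>i<n. t i = s i" "eval_fml N t ?\<theta> < r"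
      using witness by blast
    have "bdd_below ((\<lambda>a. eval_fml N (t(n + k := a)) \<theta>) ` univ N)"
      using val[OF t(1)] by (auto intro!: bdd_belowI[of _ 0])
    then obtain a where a: "a \<in> univ N" "eval_fml N (t(n + k := a)) \<theta> < r"
      using t(3) univ_nonempty by (auto simp: cINF_less_iff)
    then show "\<exists>t\<in>{..<n + Suc k} \<rightarrow> univ N. (\<forall>i<n. t i = s i) \<and> eval_fml N t \<theta> < r"
      using t by (intro bexI[of _ "t(n + k := a)"]) (auto simp: Pi_def less_Suc_eq)
  qed
qed

end

section \<open>Distances and amalgamation\<close>

definition append_tuple :: "nat \<Rightarrow> (nat \<Rightarrow> 'm) \<Rightarrow> (nat \<Rightarrow> 'm) \<Rightarrow> nat \<Rightarrow> 'm" where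
  "append_tuple n a b = (\<lambda>i\<in>{..<n + n}. if i < n then a i else b (i - n))"

lemma tuple_dist_le_iff:
  "tuple_dist N n a b \<le> r \<longleftrightarrow> 0 \<le> r \<and> (\<forall>i<n. mdist N (a i) (b i) \<le> r)"
  unfolding tuple_dist_def by auto

lemma tuple_dist_less_iff:
  "tuple_dist N n a b < r \<longleftrightarrow> 0 < r \<and> (\<forall>i<n. mdist N (a i) (b i) < r)"
  unfolding tuple_dist_def by auto

lemma tuple_dist_nonneg: "0 \<le> tuple_dist N n a b"
  using tuple_dist_le_iff[of N n a b "tuple_dist N n a b"] by simp

lemma mdist_le_tuple_dist: "i < n \<Longrightarrow> mdist N (a i) (b i) \<le> tuple_dist N n a b"
  using tuple_dist_le_iff[of N n a b "tuple_dist N n a b"] by simp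

context structure_with_parameters
begin

lemma tuple_entry: "a \<in> tuples N n \<Longrightarrow> i < n \<Longrightarrow> a i \<in> univ N"
  by auto

lemma tuple_dist_refl: "a \<in> tuples N n \<Longrightarrow> tuple_dist N n a a = 0"
  using tuple_dist_le_iff[of N n a a 0] tuple_dist_nonneg[of N n a a] tuple_entry[of a n]
  by (simp add: mdist_zero)

lemma tuple_dist_commute: "tuple_dist N n a b = tuple_dist N n b a"
  unfolding tuple_dist_def by (simp add: commute)

lemma tuple_dist_triangle:
  assumes "a \<in> tuples N n" "b \<in> tuples N n" "c \<in> tuples N n"
  shows "tuple_dist N n a c \<le> tuple_dist N n a b + tuple_dist N n b c"
proof -
  have "mdist N (a i) (c i) \<le> tuple_dist N n a b + tuple_dist N n b c" if "i < n" for i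
    using triangle[of "a i" "b i" "c i"] mdist_le_tuple_dist[OF that, of N a b]
      mdist_le_tuple_dist[OF that, of N b c] tuple_entry[OF _ that] assms
    by fastforce
  then show ?thesis
    by (simp add: tuple_dist_le_iff tuple_dist_nonneg add_nonneg_nonneg)
qed

lemma append_tuple_in:
  assumes "a \<in> tuples N n" "b \<in> tuples N n"
  shows "append_tuple n a b \<in> tuples N (n + n)"
proof -
  have "(if i < n then a i else b (i - n)) \<in> univ N" if "i < n + n" for i
    using tuple_entry[OF assms(1), of i] tuple_entry[OF assms(2), of "i - n"] that by simp
  then show ?thesis by (simp add: append_tuple_def PiE_iff)
qed

lemma eval_append_left:
  "\<phi> \<in> formulas L n A \<Longrightarrow> eval_fml N (append_tuple n a b) \<phi> = eval_fml N a \<phi>"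
  by (rule eval_formulas_cong) (auto simp: append_tuple_def)

lemma eval_append_right:
  "\<phi> \<in> formulas L n A \<Longrightarrow> eval_fml N (append_tuple n a b) (shift_fml n \<phi>) = eval_fml N b \<phi>"
  unfolding eval_shift_fml by (rule eval_formulas_cong) (auto simp: append_tuple_def)

text \<open>
  The existence of \<open>b\<close> is expressed, up to any error, by a formula over \<open>A\<close> in the variables of
  \<open>c'\<close>, namely the infimum over the second half of the variables of a maximum of deviations.  The
  value of this formula is the same at \<open>c\<close>.
\<close>

lemma approximate_transfer:
  assumes c: "c \<in> tuples N n" "c' \<in> tuples N n"
    and same: "\<And>\<phi>. \<phi> \<in> formulas L n A \<Longrightarrow> eval_fml N c \<phi> = eval_fml N c' \<phi>"
    and b: "b \<in> tuples N n" and F: "finite F" "F \<subseteq> formulas L (n + n) A" and "\<eta> > 0"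
  shows "\<exists>b'\<in>tuples N n. \<forall>\<theta>\<in>F. \<bar>eval_fml N (append_tuple n c b') \<theta> - eval_fml N (append_tuple n c' b) \<theta>\<bar> < \<eta>"
proof -
  let ?v = "eval_fml N (append_tuple n c' b)"
  \<comment> \<open>Upper bounds for the formulas in \<open>G\<close> are bounds from both sides for those in \<open>F\<close>.\<close>
  define G where "G = F \<union> Neg ` F"
  have G: "finite G" "G \<subseteq> formulas L (n + n) A" using F by (auto simp: G_def)
  have val: "append_tuple n c' b \<in> {..<n + n} \<rightarrow> univ N" using append_tuple_in[OF c(2) b] by auto
  have "\<exists>k q. k \<in> formulas L 0 A \<and> (\<forall>s. eval_fml N s k = q) \<and> ?v \<theta> \<le> q \<and> q < ?v \<theta> + \<eta> / 2"
    if "\<theta> \<in> G" for \<theta>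
  proof -
    have "0 \<le> ?v \<theta>" "?v \<theta> \<le> 1" "?v \<theta> < ?v \<theta> + \<eta> / 2"
      using eval_bounds[of \<theta> "n + n"] val G that \<open>\<eta> > 0\<close> by auto
    from sentence_between[OF this] show ?thesis by blast
  qed
  then obtain k q where kq: "\<And>\<theta>. \<theta> \<in> G \<Longrightarrow> k \<theta> \<in> formulas L 0 A \<and>
      (\<forall>s. eval_fml N s (k \<theta>) = q \<theta>) \<and> ?v \<theta> \<le> q \<theta> \<and> q \<theta> < ?v \<theta> + \<eta> / 2"
    by metis
  define H where "H = (\<lambda>\<theta>. Minus \<theta> (k \<theta>)) ` G"
  have H: "finite H" "H \<subseteq> formulas L (n + n) A"
    using G kq sentence_formulas by (auto simp: H_def)
  obtain \<mu> where \<mu>: "\<mu> \<in> formulas L (n + n) A"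
    and max: "\<And>s r. s \<in> {..<n + n} \<rightarrow> univ N \<Longrightarrow> r \<ge> 0 \<Longrightarrow>
      eval_fml N s \<mu> \<le> r \<longleftrightarrow> (\<forall>\<phi>\<in>H. eval_fml N s \<phi> \<le> r)"
    using maximum_formula[OF H] by blast
  obtain \<xi> where \<xi>: "\<xi> \<in> formulas L n A"
    and lower: "\<And>s t. s \<in> {..<n} \<rightarrow> univ N \<Longrightarrow> t \<in> {..<n + n} \<rightarrow> univ N \<Longrightarrow> \<forall>i<n. t i = s i \<Longrightarrow>
      eval_fml N s \<xi> \<le> eval_fml N t \<mu>"
    and witness: "\<And>s r. s \<in> {..<n} \<rightarrow> univ N \<Longrightarrow> r > eval_fml N s \<xi> \<Longrightarrow>
      \<exists>t\<in>{..<n + n} \<rightarrow> univ N. (\<forall>i<n. t i = s i) \<and> eval_fml N t \<mu> < r"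
    using block_infimum_formula[OF \<mu>] by blast
  have cs: "c \<in> {..<n} \<rightarrow> univ N" "c' \<in> {..<n} \<rightarrow> univ N" using c by auto
  have "?v \<mu> \<le> 0"
    using max[OF val, of 0] kq by (auto simp: H_def)
  moreover have "eval_fml N c' \<xi> \<le> ?v \<mu>"
    by (rule lower[OF cs(2) val]) (auto simp: append_tuple_def)
  ultimately have "eval_fml N c \<xi> < \<eta> / 2" using same[OF \<xi>] \<open>\<eta> > 0\<close> by linarith
  then obtain t where t: "t \<in> {..<n + n} \<rightarrow> univ N" "\<forall>i<n. t i = c i" "eval_fml N t \<mu> < \<eta> / 2"
    using witness[OF cs(1)] by blast
  define b' where "b' = (\<lambda>i\<in>{..<n}. t (n + i))"
  have b': "b' \<in> tuples N n" using t(1) by (auto simp: b'_def)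
  have agree: "eval_fml N (append_tuple n c b') \<theta> = eval_fml N t \<theta>" if "\<theta> \<in> G" for \<theta>
    using G that t(2) by (intro eval_formulas_cong[of \<theta> L "n + n" A])
      (auto simp: append_tuple_def b'_def)
  have upper: "eval_fml N (append_tuple n c b') \<theta> < ?v \<theta> + \<eta>" if "\<theta> \<in> G" for \<theta>
  proof -
    have "eval_fml N t (Minus \<theta> (k \<theta>)) \<le> \<eta> / 2"
      using max[OF t(1), of "\<eta> / 2"] t(3) \<open>\<eta> > 0\<close> that by (auto simp: H_def)
    moreover have "eval_fml N t \<theta> - q \<theta> \<le> eval_fml N t (Minus \<theta> (k \<theta>))"
      using kq[OF that] by simp
    ultimately show ?thesis using kq[OF that] unfolding agree[OF that] by linarith
  qed
  have "\<bar>eval_fml N (append_tuple n c b') \<theta> - ?v \<theta>\<bar> < \<eta>" if "\<theta> \<in> F" for \<theta>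
    using upper[of \<theta>] upper[of "Neg \<theta>"] that by (auto simp: G_def)
  with b' show ?thesis by blast
qed

text \<open>
  That a value is at most, or at least, a given dyadic number is a condition of the form \<open>\<psi> = 0\<close>.
  The function \<open>p\<close> is only assumed to be approximated by types, so it has to be derived from the
  approximations that \<open>p\<close> respects truncated subtraction where this is used.
\<close>

lemma zero_set_determines:
  assumes approx: "\<And>F \<delta>. finite F \<Longrightarrow> F \<subseteq> formulas L n A \<Longrightarrow> \<delta> > 0 \<Longrightarrow>
      \<exists>a\<in>tuples N n. \<forall>\<phi>\<in>F. \<bar>eval_fml N a \<phi> - p \<phi>\<bar> < \<delta>"
    and a: "a \<in> {..<n} \<rightarrow> univ N"
    and zero: "\<And>\<phi>. \<phi> \<in> formulas L n A \<Longrightarrow> p \<phi> = 0 \<Longrightarrow> eval_fml N a \<phi> = 0"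
    and \<phi>: "\<phi> \<in> formulas L n A"
  shows "eval_fml N a \<phi> = p \<phi>"
proof -
  have bounds: "0 \<le> p \<phi>" "p \<phi> \<le> 1"
  proof -
    have near: "0 \<le> p \<phi> + \<delta> \<and> p \<phi> \<le> 1 + \<delta>" if "\<delta> > 0" for \<delta>
    proof -
      obtain b where "b \<in> tuples N n" "\<bar>eval_fml N b \<phi> - p \<phi>\<bar> < \<delta>"
        using approx[of "{\<phi>}" \<delta>] \<phi> \<open>\<delta> > 0\<close> by auto
      moreover from this have "0 \<le> eval_fml N b \<phi>" "eval_fml N b \<phi> \<le> 1"
        using eval_bounds[OF \<phi>, of b] by auto
      ultimately show ?thesis by linarith
    qed
    show "0 \<le> p \<phi>" by (rule field_le_epsilon) (simp add: near)
    show "p \<phi> \<le> 1" by (rule field_le_epsilon) (simp add: near)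
  qed
  have Minus_zero: "p (Minus \<psi> \<psi>') = 0"
    if \<psi>: "\<psi> \<in> formulas L n A" "\<psi>' \<in> formulas L n A"
      and le: "\<And>b. b \<in> tuples N n \<Longrightarrow> eval_fml N b \<psi> - eval_fml N b \<psi>' \<le> \<bar>eval_fml N b \<phi> - p \<phi>\<bar>" for \<psi> \<psi>'
  proof (rule ccontr)
    assume "p (Minus \<psi> \<psi>') \<noteq> 0"
    then obtain b where b: "b \<in> tuples N n" and
      near: "\<forall>\<theta>\<in>{\<phi>, Minus \<psi> \<psi>'}. \<bar>eval_fml N b \<theta> - p \<theta>\<bar> < \<bar>p (Minus \<psi> \<psi>')\<bar> / 2"
      using approx[of "{\<phi>, Minus \<psi> \<psi>'}" "\<bar>p (Minus \<psi> \<psi>')\<bar> / 2"] \<psi> \<phi> by auto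
    have "0 \<le> eval_fml N b (Minus \<psi> \<psi>')" "eval_fml N b (Minus \<psi> \<psi>') \<le> \<bar>eval_fml N b \<phi> - p \<phi>\<bar>"
      using le[OF b] by auto
    moreover have "\<bar>eval_fml N b \<phi> - p \<phi>\<bar> < \<bar>p (Minus \<psi> \<psi>')\<bar> / 2"
      "\<bar>eval_fml N b (Minus \<psi> \<psi>') - p (Minus \<psi> \<psi>')\<bar> < \<bar>p (Minus \<psi> \<psi>')\<bar> / 2"
      using near by blast+
    ultimately show False by linarith
  qed
  have abounds: "0 \<le> eval_fml N a \<phi>" "eval_fml N a \<phi> \<le> 1" using eval_bounds[OF \<phi> a] .
  show ?thesis
  proof (rule antisym; rule ccontr)
    assume "\<not> eval_fml N a \<phi> \<le> p \<phi>"
    then obtain c q where c: "c \<in> formulas L n A" "\<forall>s. eval_fml N s c = q" "p \<phi> \<le> q" "q < eval_fml N a \<phi>"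
      using sentence_between[OF bounds, of "eval_fml N a \<phi>"] sentence_formulas by auto
    then have "p (Minus \<phi> c) = 0" using \<phi> by (intro Minus_zero) auto
    then show False using zero[of "Minus \<phi> c"] \<phi> c by auto
  next
    assume "\<not> p \<phi> \<le> eval_fml N a \<phi>"
    then obtain c q where c: "c \<in> formulas L n A" "\<forall>s. eval_fml N s c = q" "eval_fml N a \<phi> < q" "q \<le> p \<phi>"
      using sentence_below[OF bounds, of "eval_fml N a \<phi>"] sentence_formulas by auto
    then have "p (Minus c \<phi>) = 0" using \<phi> by (intro Minus_zero) auto
    then show False using zero[of "Minus c \<phi>"] \<phi> c by auto
  qed
qed

end

text \<open>
  Only partial types over one set \<open>A\<close> have to be realised for the study of the types over \<open>A\<close>.  A
  saturated extension of a model has this property for every subset of the model.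
\<close>

locale saturated_over = structure_with_parameters +
  assumes realised: "\<pi> \<subseteq> formulas L n A \<Longrightarrow> consistent_in N n \<pi> \<Longrightarrow> solutions N n \<pi> \<noteq> {}"
begin

text \<open>
  Compactness for pairs of types: the two types and the distance condition form a partial type in
  twice as many variables, and the approximations say that it is consistent.
\<close>

lemma realise_pair:
  assumes approx: "\<And>F \<delta>. finite F \<Longrightarrow> F \<subseteq> formulas L n A \<Longrightarrow> \<delta> > 0 \<Longrightarrow>
      \<exists>a\<in>tuples N n. \<exists>b\<in>tuples N n. (\<forall>\<phi>\<in>F. \<bar>eval_fml N a \<phi> - p \<phi>\<bar> < \<delta> \<and> \<bar>eval_fml N b \<phi> - q \<phi>\<bar> < \<delta>) \<and>
        tuple_dist N n a b < r + \<delta>"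
  shows "\<exists>a\<in>tuples N n. \<exists>b\<in>tuples N n.
    (\<forall>\<phi>\<in>formulas L n A. eval_fml N a \<phi> = p \<phi> \<and> eval_fml N b \<phi> = q \<phi>) \<and> tuple_dist N n a b \<le> r"
proof -
  have near: "0 \<le> r + \<delta>" if \<delta>: "\<delta> > 0" for \<delta>
  proof -
    obtain a b where "tuple_dist N n a b < r + \<delta>"
      using approx[of "{}" \<delta>] \<delta> by auto
    then show ?thesis using tuple_dist_nonneg[of N n a b] by linarith
  qed
  have r: "0 \<le> r" by (rule field_le_epsilon) (rule near)
  define P where "P = {\<phi> \<in> formulas L n A. p \<phi> = 0}"
  define Q where "Q = {\<phi> \<in> formulas L n A. q \<phi> = 0}"
  \<comment> \<open>The distance is bounded by \<open>r\<close> through the dyadic numbers above \<open>r\<close>.\<close>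
  define R where "R = {Minus (Dist (Var i) (Var (i + n))) c | i c. i < n \<and> c \<in> formulas L 0 A \<and>
    (\<exists>u\<ge>r. \<forall>s. eval_fml N s c = u)}"
  define \<pi> where "\<pi> = P \<union> shift_fml n ` Q \<union> R"
  have \<pi>: "\<pi> \<subseteq> formulas L (n + n) A"
  proof -
    have "P \<subseteq> formulas L (n + n) A"
      using formulas_mono[of n "n + n" A A L] by (auto simp: P_def)
    moreover have "shift_fml n ` Q \<subseteq> formulas L (n + n) A"
      by (auto simp: Q_def intro: shift_formulas)
    moreover have "R \<subseteq> formulas L (n + n) A"
      using sentence_formulas[of _ "n + n"] by (auto simp: R_def) (auto simp: formulas_def)
    ultimately show ?thesis by (auto simp: \<pi>_def)
  qed
  have "consistent_in N (n + n) \<pi>"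
    unfolding consistent_in_def
  proof (intro allI impI)
    fix \<pi>\<^sub>0 :: "('a, 'b, 'c) fml set" and \<delta> :: real
    assume sub: "\<pi>\<^sub>0 \<subseteq> \<pi>" and fin: "finite \<pi>\<^sub>0" and \<delta>: "\<delta> > 0"
    obtain G where G: "G \<subseteq> Q" "finite G" "\<pi>\<^sub>0 \<inter> shift_fml n ` Q = shift_fml n ` G"
      using finite_subset_image[of "\<pi>\<^sub>0 \<inter> shift_fml n ` Q" "shift_fml n" Q] fin by auto
    have "finite (\<pi>\<^sub>0 \<inter> P \<union> G)" "\<pi>\<^sub>0 \<inter> P \<union> G \<subseteq> formulas L n A"
      using fin G by (auto simp: P_def Q_def)
    from approx[OF this \<delta>] obtain a b where a: "a \<in> tuples N n" and b: "b \<in> tuples N n"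
      and ab: "\<forall>\<phi>\<in>\<pi>\<^sub>0 \<inter> P \<union> G. \<bar>eval_fml N a \<phi> - p \<phi>\<bar> < \<delta> \<and> \<bar>eval_fml N b \<phi> - q \<phi>\<bar> < \<delta>"
      and dist: "tuple_dist N n a b < r + \<delta>"
      by (elim bexE conjE)
    have "eval_fml N (append_tuple n a b) \<phi> \<le> \<delta>" if \<phi>: "\<phi> \<in> \<pi>\<^sub>0" for \<phi>
    proof -
      consider "\<phi> \<in> \<pi>\<^sub>0 \<inter> P" | "\<phi> \<in> shift_fml n ` G" | "\<phi> \<in> R"
      proof -
        have "\<phi> \<in> P \<or> \<phi> \<in> shift_fml n ` Q \<or> \<phi> \<in> R"
          using \<phi> sub by (auto simp: \<pi>_def)
        moreover have "\<phi> \<in> shift_fml n ` Q \<Longrightarrow> \<phi> \<in> shift_fml n ` G"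
          using \<phi> unfolding G(3)[symmetric] by simp
        ultimately show thesis using that \<phi> by (elim disjE) auto
      qed
      then show ?thesis
      proof cases
        case 1
        then have "p \<phi> = 0" "\<phi> \<in> formulas L n A" by (auto simp: P_def)
        then show ?thesis using bspec[OF ab, of \<phi>] 1 by (simp add: eval_append_left abs_less_iff)
      next
        case 2
        then obtain \<psi> where "\<psi> \<in> G" "\<phi> = shift_fml n \<psi>" by auto
        moreover from this have "q \<psi> = 0" "\<psi> \<in> formulas L n A" using G by (auto simp: Q_def)
        ultimately show ?thesis using bspec[OF ab, of \<psi>] by (simp add: eval_append_right abs_less_iff)
      next
        case 3
        then obtain i c u where "\<phi> = Minus (Dist (Var i) (Var (i + n))) c" "i < n"
          "u \<ge> r" "\<forall>s. eval_fml N s c = u"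
          unfolding R_def by blast
        then show ?thesis using mdist_le_tuple_dist[of i n N a b] dist \<delta> by (simp add: append_tuple_def)
      qed
    qed
    then show "\<exists>a\<in>tuples N (n + n). \<forall>\<phi>\<in>\<pi>\<^sub>0. eval_fml N a \<phi> \<le> \<delta>"
      using append_tuple_in[OF a b] by blast
  qed
  then obtain t where t: "t \<in> tuples N (n + n)" "\<And>\<phi>. \<phi> \<in> \<pi> \<Longrightarrow> eval_fml N t \<phi> = 0"
    using realised[OF \<pi>] by (auto simp: solutions_def)
  define a where "a = (\<lambda>i\<in>{..<n}. t i)"
  define b where "b = (\<lambda>i\<in>{..<n}. t (i + n))"
  have a: "a \<in> tuples N n" and b: "b \<in> tuples N n"
    using t(1) by (auto simp: a_def b_def PiE_iff)
  have ea: "eval_fml N a \<phi> = eval_fml N t \<phi>" if "\<phi> \<in> formulas L n A" for \<phi>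
    using that by (rule eval_formulas_cong) (auto simp: a_def)
  have eb: "eval_fml N b \<phi> = eval_fml N t (shift_fml n \<phi>)" if "\<phi> \<in> formulas L n A" for \<phi>
    unfolding eval_shift_fml using that by (rule eval_formulas_cong) (auto simp: b_def)
  have "eval_fml N a \<phi> = p \<phi>" if "\<phi> \<in> formulas L n A" for \<phi>
  proof (rule zero_set_determines[OF _ _ _ that])
    show "\<exists>a\<in>tuples N n. \<forall>\<phi>\<in>F. \<bar>eval_fml N a \<phi> - p \<phi>\<bar> < \<delta>"
      if "finite F" "F \<subseteq> formulas L n A" "\<delta> > 0" for F \<delta>
      using approx[OF that] by blast
    show "eval_fml N a \<phi> = 0" if "\<phi> \<in> formulas L n A" "p \<phi> = 0" for \<phi>
      using that t(2)[of \<phi>] ea[of \<phi>] by (simp add: \<pi>_def P_def)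
  qed (use a in auto)
  moreover have "eval_fml N b \<phi> = q \<phi>" if "\<phi> \<in> formulas L n A" for \<phi>
  proof (rule zero_set_determines[OF _ _ _ that])
    show "\<exists>a\<in>tuples N n. \<forall>\<phi>\<in>F. \<bar>eval_fml N a \<phi> - q \<phi>\<bar> < \<delta>"
      if "finite F" "F \<subseteq> formulas L n A" "\<delta> > 0" for F \<delta>
      using approx[OF that] by blast
    show "eval_fml N b \<phi> = 0" if "\<phi> \<in> formulas L n A" "q \<phi> = 0" for \<phi>
      using that t(2)[of "shift_fml n \<phi>"] eb[of \<phi>] by (simp add: \<pi>_def Q_def)
  qed (use b in auto)
  moreover have "mdist N (a i) (b i) \<le> r" if i: "i < n" for i
  proof (rule ccontr)
    assume "\<not> mdist N (a i) (b i) \<le> r"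
    moreover from this have "r \<le> 1"
      using mdist_le_1[OF tuple_entry[OF a i] tuple_entry[OF b i]] by linarith
    ultimately obtain c u where c: "c \<in> formulas L 0 A" "\<forall>s. eval_fml N s c = u" "r \<le> u"
      "u < mdist N (a i) (b i)"
      using sentence_between[OF r, of "mdist N (a i) (b i)"] by auto
    then have "Minus (Dist (Var i) (Var (i + n))) c \<in> \<pi>" using i by (auto simp: \<pi>_def R_def)
    from t(2)[OF this] show False using c i by (simp add: a_def b_def)
  qed
  ultimately show ?thesis
    using a b r by (intro bexI[of _ a] bexI[of _ b]) (auto simp: tuple_dist_le_iff)
qed

lemma realise_type:
  assumes "\<And>F \<delta>. finite F \<Longrightarrow> F \<subseteq> formulas L n A \<Longrightarrow> \<delta> > 0 \<Longrightarrow>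
      \<exists>a\<in>tuples N n. \<forall>\<phi>\<in>F. \<bar>eval_fml N a \<phi> - p \<phi>\<bar> < \<delta>"
  shows "\<exists>a\<in>tuples N n. \<forall>\<phi>\<in>formulas L n A. eval_fml N a \<phi> = p \<phi>"
proof -
  have "\<exists>a\<in>tuples N n. \<exists>b\<in>tuples N n. (\<forall>\<phi>\<in>formulas L n A. eval_fml N a \<phi> = p \<phi> \<and> eval_fml N b \<phi> = p \<phi>) \<and>
      tuple_dist N n a b \<le> 0"
  proof (rule realise_pair)
    fix F and \<delta> :: real assume F: "finite F" "F \<subseteq> formulas L n A" "\<delta> > 0"
    from assms[OF this] obtain a where "a \<in> tuples N n" "\<forall>\<phi>\<in>F. \<bar>eval_fml N a \<phi> - p \<phi>\<bar> < \<delta>" ..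
    then show "\<exists>a\<in>tuples N n. \<exists>b\<in>tuples N n.
        (\<forall>\<phi>\<in>F. \<bar>eval_fml N a \<phi> - p \<phi>\<bar> < \<delta> \<and> \<bar>eval_fml N b \<phi> - p \<phi>\<bar> < \<delta>) \<and> tuple_dist N n a b < 0 + \<delta>"
      using F(3) by (intro bexI[of _ a]) (auto simp: tuple_dist_refl)
  qed
  then show ?thesis by blast
qed

end

section \<open>Spaces of types\<close>

lemma openin_finitely_many_conditions:
  fixes f :: "'i \<Rightarrow> 'z \<Rightarrow> real"
  assumes "finite F" "\<And>i. i \<in> F \<Longrightarrow> continuous_map X euclideanreal (f i)"
  shows "openin X {x \<in> topspace X. \<forall>i\<in>F. \<bar>f i x - c i\<bar> < \<delta>}"
  using assms
proof (induction F)
  case (insert i F)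
  have "openin X {x \<in> topspace X. f i x \<in> {c i - \<delta><..<c i + \<delta>}}"
    using insert.prems by (intro openin_continuous_map_preimage[where Y = euclideanreal]) auto
  then have "openin X ({x \<in> topspace X. f i x \<in> {c i - \<delta><..<c i + \<delta>}} \<inter>
      {x \<in> topspace X. \<forall>i\<in>F. \<bar>f i x - c i\<bar> < \<delta>})"
    using insert by (intro openin_Int) auto
  moreover have "{x \<in> topspace X. f i x \<in> {c i - \<delta><..<c i + \<delta>}} \<inter>
      {x \<in> topspace X. \<forall>i\<in>F. \<bar>f i x - c i\<bar> < \<delta>} = {x \<in> topspace X. \<forall>i\<in>insert i F. \<bar>f i x - c i\<bar> < \<delta>}"
    by (auto simp: abs_less_iff)
  ultimately show ?case by simp
qed simp

lemma closedin_finitely_many_conditions: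
  fixes f :: "'i \<Rightarrow> 'z \<Rightarrow> real"
  assumes "finite F" "\<And>i. i \<in> F \<Longrightarrow> continuous_map X euclideanreal (f i)"
  shows "closedin X {x \<in> topspace X. \<forall>i\<in>F. \<bar>f i x - c i\<bar> \<le> \<delta>}"
  using assms
proof (induction F)
  case (insert i F)
  have "closedin X {x \<in> topspace X. f i x \<in> {c i - \<delta>..c i + \<delta>}}"
    using insert.prems by (intro closedin_continuous_map_preimage[where Y = euclideanreal]) auto
  then have "closedin X ({x \<in> topspace X. f i x \<in> {c i - \<delta>..c i + \<delta>}} \<inter>
      {x \<in> topspace X. \<forall>i\<in>F. \<bar>f i x - c i\<bar> \<le> \<delta>})"
    using insert by (intro closedin_Int) auto
  moreover have "{x \<in> topspace X. f i x \<in> {c i - \<delta>..c i + \<delta>}} \<inter>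
      {x \<in> topspace X. \<forall>i\<in>F. \<bar>f i x - c i\<bar> \<le> \<delta>} = {x \<in> topspace X. \<forall>i\<in>insert i F. \<bar>f i x - c i\<bar> \<le> \<delta>}"
    by (auto simp: abs_le_iff)
  ultimately show ?case by simp
qed simp

text \<open>
  A countable base is formed by the sets that finitely many conditions \<open>f i \<in> B\<close> define, where \<open>B\<close>
  is in a countable base of the line.
\<close>

lemma second_countable_real_product:
  assumes "countable I"
  shows "second_countable (product_topology (\<lambda>_. euclideanreal) I)"
proof -
  obtain \<B> :: "real set set" where \<B>: "countable \<B>" "\<And>B. B \<in> \<B> \<Longrightarrow> open B"
    and base: "\<And>U x. open U \<Longrightarrow> x \<in> U \<Longrightarrow> \<exists>B\<in>\<B>. x \<in> B \<and> B \<subseteq> U"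
    by (metis ex_countable_basis topological_basisE topological_basis_open)
  let ?X = "product_topology (\<lambda>_. euclideanreal) I"
  define C where "C G = {f \<in> topspace ?X. \<forall>(i, B)\<in>G. f i \<in> B}" for G :: "('a \<times> real set) set"
  define \<G> where "\<G> = {G. finite G \<and> G \<subseteq> I \<times> \<B>}"
  have "countable \<G>"
    using assms \<B>(1) unfolding \<G>_def by (intro countable_Collect_finite_subset countable_SIGMA) auto
  moreover have "openin ?X (C G)" if "G \<in> \<G>" for G
  proof -
    have "finite G" "G \<subseteq> I \<times> \<B>" using that by (auto simp: \<G>_def)
    then show ?thesis
    proof (induction G)
      case empty
      have "C {} = topspace ?X" unfolding C_def by auto
      then show ?case by (metis openin_topspace)
    next
      case (insert g G)
      obtain i B where g: "g = (i, B)" "i \<in> I" "B \<in> \<B>" using insert.prems by auto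
      have "openin ?X {f \<in> topspace ?X. f i \<in> B}"
        using g \<B>(2) continuous_map_product_projection[of i I "\<lambda>_. euclideanreal"]
        by (intro openin_continuous_map_preimage[where Y = euclideanreal]) auto
      moreover have "openin ?X (C G)" using insert by simp
      moreover have "C (insert g G) = {f \<in> topspace ?X. f i \<in> B} \<inter> C G"
        by (auto simp: C_def g)
      ultimately show ?case by (simp only: openin_Int)
    qed
  qed
  moreover have "\<exists>G\<in>\<G>. x \<in> C G \<and> C G \<subseteq> U" if U: "openin ?X U" "x \<in> U" for U x
  proof -
    obtain V where V: "finite {i \<in> I. V i \<noteq> UNIV}" "\<And>i. i \<in> I \<Longrightarrow> open (V i)" "x \<in> Pi\<^sub>E I V" "Pi\<^sub>E I V \<subseteq> U"
      using U unfolding openin_product_topology_alt by auto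
    have "\<forall>i\<in>I. \<exists>B\<in>\<B>. x i \<in> B \<and> B \<subseteq> V i" using V base by (simp add: PiE_iff)
    then obtain B where B: "\<And>i. i \<in> I \<Longrightarrow> B i \<in> \<B> \<and> x i \<in> B i \<and> B i \<subseteq> V i" by metis
    define G where "G = (\<lambda>i. (i, B i)) ` {i \<in> I. V i \<noteq> UNIV}"
    have "G \<in> \<G>" using V(1) B by (auto simp: \<G>_def G_def)
    moreover have "x \<in> C G" using V(3) B by (auto simp: C_def G_def PiE_iff)
    moreover have "C G \<subseteq> Pi\<^sub>E I V"
    proof
      fix f assume f: "f \<in> C G"
      have "f i \<in> V i" if "i \<in> I" for i
        using f B[OF that] that by (cases "V i = UNIV") (auto simp: C_def G_def)
      then show "f \<in> Pi\<^sub>E I V" using f by (simp add: C_def PiE_iff)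
    qed
    ultimately show ?thesis using V(4) by blast
  qed
  ultimately show ?thesis
    unfolding second_countable_def by (intro exI[of _ "C ` \<G>"]) auto
qed

lemma type_of_apply: "\<phi> \<in> formulas L n A \<Longrightarrow> type_of L N n A a \<phi> = eval_fml N a \<phi>"
  by (simp add: type_of_def)

lemma type_of_eq_iff:
  "type_of L N n A a = type_of L N n A b \<longleftrightarrow> (\<forall>\<phi>\<in>formulas L n A. eval_fml N a \<phi> = eval_fml N b \<phi>)"
  by (auto simp: type_of_def fun_eq_iff restrict_def)

lemma type_of_in_type_space: "a \<in> tuples N n \<Longrightarrow> type_of L N n A a \<in> type_space L N n A"
  by (simp add: type_space_def)

lemma restrict_type_of:
  "B \<subseteq> A \<Longrightarrow> restrict (type_of L N n A a) (formulas L n B) = type_of L N n B a"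
  using formulas_mono[of n n B A L] by (auto simp: type_of_def fun_eq_iff restrict_def)

lemma topspace_logic_topology: "topspace (logic_topology L N n A) = type_space L N n A"
  by (auto simp: logic_topology_def type_space_def type_of_def)

lemma continuous_evaluation:
  "\<phi> \<in> formulas L n A \<Longrightarrow> continuous_map (logic_topology L N n A) euclideanreal (\<lambda>p. p \<phi>)"
  unfolding logic_topology_def
  by (intro continuous_map_from_subtopology continuous_map_product_projection)

lemma Hausdorff_logic_topology: "Hausdorff_space (logic_topology L N n A)"
  unfolding logic_topology_def
  by (intro Hausdorff_space_subtopology) (simp add: Hausdorff_space_product_topology)

lemma second_countable_logic_topology:
  "countable (formulas L n A) \<Longrightarrow> second_countable (logic_topology L N n A)"
  unfolding logic_topology_def
  by (intro second_countable_subtopology second_countable_real_product)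

lemma bdd_below_tuple_dists:
  "bdd_below {tuple_dist N n a b | a b. a \<in> tuples N n \<and> b \<in> tuples N n \<and>
     type_of L N n A a = p \<and> type_of L N n A b = q}"
  by (rule bdd_belowI[where m = 0], elim CollectE exE conjE) (simp add: tuple_dist_nonneg)

lemma type_dist_lessD:
  assumes "p \<in> type_space L N n A" "q \<in> type_space L N n A" "type_dist L N n A p q < r"
  shows "\<exists>a\<in>tuples N n. \<exists>b\<in>tuples N n. type_of L N n A a = p \<and> type_of L N n A b = q \<and> tuple_dist N n a b < r"
proof -
  let ?S = "{tuple_dist N n a b | a b. a \<in> tuples N n \<and> b \<in> tuples N n \<and>
            type_of L N n A a = p \<and> type_of L N n A b = q}"
  have "?S \<noteq> {}" using assms(1,2) by (auto simp: type_space_def)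
  from cInf_less_iff[OF this bdd_below_tuple_dists[of N n L A p q], of r] have "\<exists>x\<in>?S. x < r"
    using assms(3) unfolding type_dist_def by (rule iffD1)
  then show ?thesis by (elim bexE CollectE exE conjE) (intro bexI conjI; simp)
qed

lemma type_dist_le:
  assumes "a \<in> tuples N n" "b \<in> tuples N n"
  shows "type_dist L N n A (type_of L N n A a) (type_of L N n A b) \<le> tuple_dist N n a b"
  unfolding type_dist_def using assms
  by - (rule cInf_lower[OF CollectI bdd_below_tuple_dists], rule exI[of _ a], rule exI[of _ b], simp)

lemma type_dist_greatest:
  assumes "p \<in> type_space L N n A" "q \<in> type_space L N n A"
    and "\<And>a b. a \<in> tuples N n \<Longrightarrow> b \<in> tuples N n \<Longrightarrow> type_of L N n A a = p \<Longrightarrow> type_of L N n A b = q \<Longrightarrow>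
      r \<le> tuple_dist N n a b"
  shows "r \<le> type_dist L N n A p q"
  using type_dist_lessD[OF assms(1,2), of r] assms(3) by (meson leI not_le)

text \<open>Restricting types to fewer parameters increases the sets of realisations.\<close>

lemma type_dist_restrict_le:
  assumes "B \<subseteq> A" "p \<in> type_space L N n A" "q \<in> type_space L N n A"
  shows "type_dist L N n B (restrict p (formulas L n B)) (restrict q (formulas L n B)) \<le> type_dist L N n A p q"
proof (rule type_dist_greatest[OF assms(2,3)])
  fix a b assume "a \<in> tuples N n" "b \<in> tuples N n" "type_of L N n A a = p" "type_of L N n A b = q"
  then show "type_dist L N n B (restrict p (formulas L n B)) (restrict q (formulas L n B)) \<le> tuple_dist N n a b"
    using restrict_type_of[OF assms(1), of L N n] type_dist_le[of a n N b L B] by auto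
qed

lemma continuous_restrict:
  assumes "B \<subseteq> A"
  shows "continuous_map (logic_topology L N n A) (logic_topology L N n B) (\<lambda>p. restrict p (formulas L n B))"
proof -
  have "continuous_map (logic_topology L N n A) (product_topology (\<lambda>_. euclideanreal) (formulas L n B))
      (\<lambda>p. restrict p (formulas L n B))"
    using continuous_evaluation[of _ L n A N] formulas_mono[of n n B A L] assms
    by (auto simp: continuous_map_componentwise)
  moreover have "restrict p (formulas L n B) \<in> type_space L N n B" if "p \<in> type_space L N n A" for p
    using that assms by (auto simp: type_space_def restrict_type_of)
  ultimately show ?thesis
    by (simp add: logic_topology_def[of L N n B] continuous_map_in_subtopology topspace_logic_topology image_subset_iff)
qed

lemma restrict_type_space:
  "B \<subseteq> A \<Longrightarrow> (\<lambda>p. restrict p (formulas L n B)) ` type_space L N n A = type_space L N n B"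
  by (simp add: type_space_def image_image restrict_type_of)

context structure_with_parameters
begin

lemma type_dist_refl: "p \<in> type_space L N n A \<Longrightarrow> type_dist L N n A p p \<le> 0"
  using type_dist_le[of _ n N _ L A] by (fastforce simp: type_space_def tuple_dist_refl)

lemma type_dist_commute:
  "p \<in> type_space L N n A \<Longrightarrow> q \<in> type_space L N n A \<Longrightarrow> type_dist L N n A p q = type_dist L N n A q p"
proof -
  have "type_dist L N n A q p \<le> type_dist L N n A p q"
    if "p \<in> type_space L N n A" "q \<in> type_space L N n A" for p q
  proof (rule type_dist_greatest[OF that])
    fix a b assume "a \<in> tuples N n" "b \<in> tuples N n" "type_of L N n A a = p" "type_of L N n A b = q"
    then show "type_dist L N n A q p \<le> tuple_dist N n a b"
      using type_dist_le[of b n N a L A] by (auto simp: tuple_dist_commute[of n a b])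
  qed
  then show "p \<in> type_space L N n A \<Longrightarrow> q \<in> type_space L N n A \<Longrightarrow> type_dist L N n A p q = type_dist L N n A q p"
    by (intro antisym)
qed

end

context saturated_over
begin

text \<open>
  The space is closed in a product of unit intervals, since every point of its closure is
  approximated by types and hence realised.
\<close>

lemma compact_logic_topology: "compact_space (logic_topology L N n A)"
proof -
  let ?X = "product_topology (\<lambda>_. euclideanreal) (formulas L n A)"
  let ?S = "type_space L N n A"
  have "?S \<subseteq> (formulas L n A \<rightarrow>\<^sub>E {0..1})"
  proof
    fix p assume "p \<in> ?S"
    then obtain a where a: "a \<in> tuples N n" "p = type_of L N n A a" by (auto simp: type_space_def)
    have "eval_fml N a \<phi> \<in> {0..1}" if "\<phi> \<in> formulas L n A" for \<phi>
      using eval_bounds[OF that, of a] a(1) by (auto simp: PiE_iff)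
    then show "p \<in> formulas L n A \<rightarrow>\<^sub>E {0..1}" by (simp add: a(2) type_of_def)
  qed
  moreover have "compactin ?X (formulas L n A \<rightarrow>\<^sub>E {0..1})"
    by (simp add: compactin_PiE)
  moreover have "closedin ?X ?S"
  proof -
    have "?X closure_of ?S \<subseteq> ?S"
    proof
      fix p assume p: "p \<in> ?X closure_of ?S"
      then have ptop: "p \<in> topspace ?X" by (simp add: in_closure_of)
      have "\<exists>a\<in>tuples N n. \<forall>\<phi>\<in>formulas L n A. eval_fml N a \<phi> = p \<phi>"
      proof (rule realise_type)
        fix F and \<delta> :: real assume F: "finite F" "F \<subseteq> formulas L n A" "\<delta> > 0"
        define U where "U = {x \<in> topspace ?X. \<forall>\<phi>\<in>F. \<bar>x \<phi> - p \<phi>\<bar> < \<delta>}"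
        have "openin ?X U"
          unfolding U_def
          using F by (intro openin_finitely_many_conditions continuous_map_product_projection) auto
        moreover have "p \<in> U"
          using ptop F(3) by (simp add: U_def)
        moreover have "\<forall>T. p \<in> T \<and> openin ?X T \<longrightarrow> (\<exists>x. x \<in> ?S \<and> x \<in> T)"
          using p unfolding in_closure_of by (rule conjunct2)
        ultimately obtain x where "x \<in> ?S" "x \<in> U" by auto
        then obtain a where a: "a \<in> tuples N n" "type_of L N n A a \<in> U"
          by (auto simp: type_space_def)
        have "\<bar>eval_fml N a \<phi> - p \<phi>\<bar> < \<delta>" if "\<phi> \<in> F" for \<phi>
        proof -
          have "\<bar>type_of L N n A a \<phi> - p \<phi>\<bar> < \<delta>" using a(2) that by (simp add: U_def)
          then show ?thesis using that F(2) by (simp add: type_of_apply subsetD)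
        qed
        with a(1) show "\<exists>a\<in>tuples N n. \<forall>\<phi>\<in>F. \<bar>eval_fml N a \<phi> - p \<phi>\<bar> < \<delta>"
          by (intro bexI[of _ a]) auto
      qed
      then obtain a where a: "a \<in> tuples N n" "\<forall>\<phi>\<in>formulas L n A. eval_fml N a \<phi> = p \<phi>" by blast
      have "type_of L N n A a = p"
        using a(2) ptop by (auto simp: type_of_def PiE_iff extensional_def fun_eq_iff)
      then show "p \<in> ?S" using a(1) by (auto simp: type_space_def)
    qed
    moreover have "?S \<subseteq> topspace ?X" by (auto simp: type_space_def type_of_def)
    ultimately show ?thesis unfolding closure_of_subset_eq[symmetric] by (intro conjI)
  qed
  ultimately have "compactin ?X ?S" by (metis closed_compactin)
  then show ?thesis by (simp add: logic_topology_def compact_space_subtopology)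
qed

text \<open>
  If there were types arbitrarily close to \<open>p\<close> and \<open>q\<close> with distances at most \<open>\<epsilon>\<close>, then
  realisations of these would approximate realisations of \<open>p\<close> and \<open>q\<close> at distance at most \<open>\<epsilon>\<close>.
\<close>

lemma type_dist_lower_semicontinuous:
  assumes p: "p \<in> type_space L N n A" and q: "q \<in> type_space L N n A" and gt: "\<epsilon> < type_dist L N n A p q"
  shows "\<exists>F \<delta>. finite F \<and> F \<subseteq> formulas L n A \<and> \<delta> > 0 \<and>
    (\<forall>u\<in>type_space L N n A. \<forall>v\<in>type_space L N n A.
       (\<forall>\<phi>\<in>F. \<bar>u \<phi> - p \<phi>\<bar> < \<delta> \<and> \<bar>v \<phi> - q \<phi>\<bar> < \<delta>) \<longrightarrow> \<epsilon> < type_dist L N n A u v)"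
proof (rule ccontr)
  assume contra: "\<not> ?thesis"
  have "\<exists>a\<in>tuples N n. \<exists>b\<in>tuples N n.
    (\<forall>\<phi>\<in>formulas L n A. eval_fml N a \<phi> = p \<phi> \<and> eval_fml N b \<phi> = q \<phi>) \<and> tuple_dist N n a b \<le> \<epsilon>"
  proof (rule realise_pair)
    fix F and \<delta> :: real assume F: "finite F" "F \<subseteq> formulas L n A" "\<delta> > 0"
    then obtain u v where uv: "u \<in> type_space L N n A" "v \<in> type_space L N n A"
      "\<forall>\<phi>\<in>F. \<bar>u \<phi> - p \<phi>\<bar> < \<delta> \<and> \<bar>v \<phi> - q \<phi>\<bar> < \<delta>" "\<not> \<epsilon> < type_dist L N n A u v"
      using contra by blast
    have "type_dist L N n A u v < \<epsilon> + \<delta>" using uv(4) F(3) by linarith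
    then obtain a b where ab: "a \<in> tuples N n" "b \<in> tuples N n" "type_of L N n A a = u" "type_of L N n A b = v"
      "tuple_dist N n a b < \<epsilon> + \<delta>"
      using type_dist_lessD[OF uv(1,2)] by blast
    have "eval_fml N a \<phi> = u \<phi> \<and> eval_fml N b \<phi> = v \<phi>" if "\<phi> \<in> F" for \<phi>
      using that F(2) ab(3,4) type_of_apply[of \<phi> L n A N] by auto
    then show "\<exists>a\<in>tuples N n. \<exists>b\<in>tuples N n.
        (\<forall>\<phi>\<in>F. \<bar>eval_fml N a \<phi> - p \<phi>\<bar> < \<delta> \<and> \<bar>eval_fml N b \<phi> - q \<phi>\<bar> < \<delta>) \<and> tuple_dist N n a b < \<epsilon> + \<delta>"
      using ab(1,2,5) uv(3) by (intro bexI[of _ a] bexI[of _ b] conjI) auto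
  qed
  then obtain a b where ab: "a \<in> tuples N n" "b \<in> tuples N n" "tuple_dist N n a b \<le> \<epsilon>"
    "\<forall>\<phi>\<in>formulas L n A. eval_fml N a \<phi> = p \<phi> \<and> eval_fml N b \<phi> = q \<phi>"
    by blast
  obtain a' b' where "p = type_of L N n A a'" "q = type_of L N n A b'"
    using p q by (auto simp: type_space_def)
  then have "p = type_of L N n A a" "q = type_of L N n A b"
    using ab(4) by (auto simp: type_of_eq_iff type_of_apply)
  then have "type_dist L N n A p q \<le> \<epsilon>"
    using type_dist_le[OF ab(1,2), of L A] ab(3) by simp
  with gt show False by simp
qed

text \<open>
  Realisations \<open>a\<close> of \<open>p\<close> and \<open>b\<close> of \<open>q\<close> are close to different realisations \<open>c\<close> and \<open>c'\<close> of \<open>r\<close>.  As \<open>c\<close> and \<open>c'\<close> have the same type, some \<open>b'\<close> almost realises \<open>q\<close> and is almost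
  as close to \<open>c\<close>, and compactness removes the two errors.
\<close>

lemma type_dist_triangle:
  assumes p: "p \<in> type_space L N n A" and r: "r \<in> type_space L N n A" and q: "q \<in> type_space L N n A"
  shows "type_dist L N n A p q \<le> type_dist L N n A p r + type_dist L N n A r q"
proof (rule field_le_epsilon)
  fix e :: real assume e: "e > 0"
  let ?d = "type_dist L N n A"
  obtain a c where ac: "a \<in> tuples N n" "c \<in> tuples N n" "type_of L N n A a = p" "type_of L N n A c = r"
    "tuple_dist N n a c < ?d p r + e / 2"
    using type_dist_lessD[OF p r, of "?d p r + e / 2"] e by auto
  obtain c' b where cb: "c' \<in> tuples N n" "b \<in> tuples N n" "type_of L N n A c' = r" "type_of L N n A b = q"
    "tuple_dist N n c' b < ?d r q + e / 2"
    using type_dist_lessD[OF r q, of "?d r q + e / 2"] e by auto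
  have same: "eval_fml N c \<phi> = eval_fml N c' \<phi>" if "\<phi> \<in> formulas L n A" for \<phi>
    using ac(4) cb(3) that type_of_eq_iff[of L N n A c c'] by auto
  have "\<exists>a'\<in>tuples N n. \<exists>b'\<in>tuples N n.
    (\<forall>\<phi>\<in>formulas L n A. eval_fml N a' \<phi> = p \<phi> \<and> eval_fml N b' \<phi> = q \<phi>) \<and>
    tuple_dist N n a' b' \<le> tuple_dist N n a c + tuple_dist N n c' b"
  proof (rule realise_pair)
    fix F and \<delta> :: real assume F: "finite F" "F \<subseteq> formulas L n A" "\<delta> > 0"
    define G where "G = shift_fml n ` F \<union> (\<lambda>i. Dist (Var i) (Var (i + n))) ` {..<n}"
    have G: "finite G" "G \<subseteq> formulas L (n + n) A"
      using F shift_formulas[of _ L n A n] by (auto simp: G_def) (auto simp: formulas_def)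
    obtain b' where b': "b' \<in> tuples N n" and
      near: "\<forall>\<theta>\<in>G. \<bar>eval_fml N (append_tuple n c b') \<theta> - eval_fml N (append_tuple n c' b) \<theta>\<bar> < \<delta>"
      using approximate_transfer[OF ac(2) cb(1) same cb(2) G F(3)] by blast
    have "\<bar>eval_fml N a \<phi> - p \<phi>\<bar> < \<delta> \<and> \<bar>eval_fml N b' \<phi> - q \<phi>\<bar> < \<delta>" if "\<phi> \<in> F" for \<phi>
    proof -
      have \<phi>: "\<phi> \<in> formulas L n A" using that F by auto
      have "shift_fml n \<phi> \<in> G" using that by (simp add: G_def)
      then have "\<bar>eval_fml N b' \<phi> - eval_fml N b \<phi>\<bar> < \<delta>"
        using near \<phi> by (metis eval_append_right)
      then show ?thesis using type_of_apply[OF \<phi>] ac(3) cb(4) F(3) by auto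
    qed
    moreover have "tuple_dist N n c b' < tuple_dist N n c' b + \<delta>"
    proof -
      have "mdist N (c i) (b' i) < tuple_dist N n c' b + \<delta>" if "i < n" for i
      proof -
        have "Dist (Var i) (Var (i + n)) \<in> G" using that by (simp add: G_def)
        from bspec[OF near this] have "\<bar>mdist N (c i) (b' i) - mdist N (c' i) (b i)\<bar> < \<delta>"
          using that by (simp add: append_tuple_def)
        then show ?thesis using mdist_le_tuple_dist[OF that, of N c' b] by linarith
      qed
      then show ?thesis
        using F(3) tuple_dist_nonneg[of N n c' b] by (simp add: tuple_dist_less_iff add_nonneg_pos)
    qed
    ultimately show "\<exists>a'\<in>tuples N n. \<exists>b'\<in>tuples N n.
        (\<forall>\<phi>\<in>F. \<bar>eval_fml N a' \<phi> - p \<phi>\<bar> < \<delta> \<and> \<bar>eval_fml N b' \<phi> - q \<phi>\<bar> < \<delta>) \<and>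
        tuple_dist N n a' b' < tuple_dist N n a c + tuple_dist N n c' b + \<delta>"
      using ac(1) b' tuple_dist_triangle[OF ac(1,2) b']
      by (intro bexI[of _ a] bexI[of _ b'] conjI ballI) auto
  qed
  then obtain a' b' where ab: "a' \<in> tuples N n" "b' \<in> tuples N n"
    "\<forall>\<phi>\<in>formulas L n A. eval_fml N a' \<phi> = p \<phi> \<and> eval_fml N b' \<phi> = q \<phi>"
    "tuple_dist N n a' b' \<le> tuple_dist N n a c + tuple_dist N n c' b"
    by blast
  then have "p = type_of L N n A a'" "q = type_of L N n A b'"
    using ac(3) cb(4) by (auto simp: type_of_eq_iff type_of_apply)
  then have "?d p q \<le> tuple_dist N n a' b'" using type_dist_le[OF ab(1,2), of L A] by simp
  then show "?d p q \<le> ?d p r + ?d r q + e" using ab(4) ac(5) cb(5) by linarith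
qed

end

section \<open>The Cantor-Bendixson analysis\<close>

text \<open>
  Burali-Forti: an injection would make the ordinals a well-order on the points, hence itself an
  ordinal \<open>\<alpha>\<close>, and sending each \<open>\<beta>\<close> to the initial segment below it would be a strictly increasing
  map of the ordinals into those below \<open>\<alpha>\<close>.
\<close>

lemma no_injection_of_ordinals: "\<not> inj (f :: 'z ordinal \<Rightarrow> 'z)"
proof
  assume f: "inj f"
  define W where "W = {(x :: 'z ordinal, y). x \<le> y}"
  have FW: "Field W = UNIV" by (auto simp: W_def Field_def)
  have "W - Id = {(x, y). x < y}" by (auto simp: W_def)
  then have "wf (W - Id)" by (simp add: wf)
  then have "Well_order W"
    unfolding well_order_on_def linear_order_on_def partial_order_on_def preorder_on_def FW
    by (auto simp: W_def refl_on_def trans_def antisym_def total_on_def)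
  define r where "r = dir_image W f"
  have r: "Well_order r"
    unfolding r_def using \<open>Well_order W\<close> f FW by (intro Well_order_dir_image) auto
  have in_r: "(f x, f y) \<in> r \<longleftrightarrow> x \<le> y" for x y
    using f by (auto simp: r_def dir_image_def W_def inj_eq)
  have under: "underS r (f x) = f ` {..<x}" for x
    using f by (force simp: underS_def r_def dir_image_def W_def inj_eq)
  have Fr: "Field r \<noteq> {}" using in_r[of undefined undefined] by (auto simp: Field_def)
  define h where "h x = abs_ordinal (Restr r (underS r (f x)))" for x
  have wo: "Well_order (Restr r (underS r a))" for a using r by (rule Well_order_Restr)
  have refl: "(s, s) \<in> ordIso" if "Well_order s" for s :: "'z rel" using that by (rule ordIso_reflexive)
  have ofil: "wo_rel.ofilter r (underS r a)" for a
    using r by (simp add: wo_rel_def wo_rel.underS_ofilter)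
  have mono: "h x < h y" if "x < y" for x y
  proof -
    have "underS r (f x) \<subset> underS r (f y)"
      unfolding under using that f by (intro image_strict_mono) (auto intro: inj_on_subset)
    then have "(Restr r (underS r (f x)), Restr r (underS r (f y))) \<in> ordLess"
      using ofilter_subset_ordLess[OF r ofil ofil] by blast
    then show ?thesis
      unfolding h_def using less_ordinal.abs_eq[OF refl[OF wo] refl[OF wo]] by blast
  qed
  have below: "h x < abs_ordinal r" for x
    unfolding h_def using less_ordinal.abs_eq[OF refl[OF wo] refl[OF r]] underS_Restr_ordLess[OF r Fr]
    by blast
  have "x \<le> h x" for x
  proof (rule ccontr)
    assume "\<not> x \<le> h x"
    then have x: "h x < x" by simp
    define y where "y = (LEAST y. h y < y)"
    have "h y < y" unfolding y_def using x by (rule LeastI)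
    then have "h (h y) < h y" by (rule mono)
    then have "y \<le> h y" unfolding y_def by (rule Least_le)
    with \<open>h y < y\<close> show False by simp
  qed
  with below[of "abs_ordinal r"] show False by (simp add: not_less[symmetric])
qed

lemma cb_derivative_subset: "cb_derivative X d \<epsilon> Z \<subseteq> Z"
  by (auto simp: cb_derivative_def)

lemma cb_derivative_closed:
  assumes "closedin X Z"
  shows "closedin X (cb_derivative X d \<epsilon> Z)"
proof -
  have "closedin (subtopology X Z) (cb_derivative X d \<epsilon> Z)"
    unfolding cb_derivative_def using closedin_subset[OF assms]
    by (metis (no_types, lifting) closedin_diff closedin_topspace mem_Collect_eq openin_Union topspace_subtopology_subset)
  then show ?thesis using assms by (rule closedin_trans_full)
qed

lemma cb_stage_cases [consumes 0, case_names zero successor limit]: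
  fixes \<alpha> :: "'o::wellorder"
  obtains "\<forall>\<beta>. \<alpha> \<le> \<beta>" "cb_stage X d \<epsilon> \<alpha> = topspace X"
  | \<beta> where "\<beta> < \<alpha>" "\<And>\<gamma>. \<gamma> < \<alpha> \<Longrightarrow> \<gamma> \<le> \<beta>" "cb_stage X d \<epsilon> \<alpha> = cb_derivative X d \<epsilon> (cb_stage X d \<epsilon> \<beta>)"
  | "{..<\<alpha>} \<noteq> {}" "\<And>\<beta>. \<beta> < \<alpha> \<Longrightarrow> \<exists>\<gamma>. \<beta> < \<gamma> \<and> \<gamma> < \<alpha>"
    "cb_stage X d \<epsilon> \<alpha> = (\<Inter>\<beta>\<in>{..<\<alpha>}. cb_stage X d \<epsilon> \<beta>)"
proof -
  consider "\<forall>\<beta>. \<alpha> \<le> \<beta>" | "\<not> (\<forall>\<beta>. \<alpha> \<le> \<beta>)" "\<exists>\<beta><\<alpha>. \<forall>\<gamma><\<alpha>. \<gamma> \<le> \<beta>"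
    | "\<not> (\<forall>\<beta>. \<alpha> \<le> \<beta>)" "\<not> (\<exists>\<beta><\<alpha>. \<forall>\<gamma><\<alpha>. \<gamma> \<le> \<beta>)" by blast
  then show thesis
  proof cases
    case 1
    then show ?thesis by (intro that(1)) (simp_all add: cb_stage.simps)
  next
    case 2
    then obtain \<beta> where \<beta>: "\<beta> < \<alpha>" "\<forall>\<gamma><\<alpha>. \<gamma> \<le> \<beta>" by blast
    then have greatest: "(GREATEST \<beta>. \<beta> < \<alpha>) = \<beta>" by (intro Greatest_equality) auto
    have "cb_stage X d \<epsilon> \<alpha> = cb_derivative X d \<epsilon> (cb_stage X d \<epsilon> \<beta>)"
      by (subst cb_stage.simps) (simp only: 2 greatest if_True if_False)
    with \<beta> show ?thesis by (intro that(2)[of \<beta>]) auto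
  next
    case 3
    have "cb_stage X d \<epsilon> \<alpha> = (\<Inter>\<beta>\<in>{..<\<alpha>}. cb_stage X d \<epsilon> \<beta>)"
      by (subst cb_stage.simps) (simp only: 3 if_False)
    moreover from 3(1) have "{..<\<alpha>} \<noteq> {}" by (auto simp: not_le)
    ultimately show ?thesis using 3(2) by (intro that(3)) (auto simp: not_le)
  qed
qed

lemma cb_stage_closed: "closedin X (cb_stage X d \<epsilon> \<alpha>)"
proof (induction \<alpha> rule: less_induct)
  case (less \<alpha>)
  show ?case
  proof (cases rule: cb_stage_cases[where \<alpha> = \<alpha> and X = X and d = d and \<epsilon> = \<epsilon>])
    case (successor \<beta>)
    then show ?thesis using less by (simp add: cb_derivative_closed)
  next
    case limit
    then show ?thesis using less by (auto intro!: closedin_Inter)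
  qed simp
qed

lemma cb_stage_decreasing:
  "\<alpha> < \<beta> \<Longrightarrow> cb_stage X d \<epsilon> \<beta> \<subseteq> cb_derivative X d \<epsilon> (cb_stage X d \<epsilon> \<alpha>)"
proof (induction \<beta> rule: less_induct)
  case (less \<beta>)
  show ?case
  proof (cases rule: cb_stage_cases[where \<alpha> = \<beta> and X = X and d = d and \<epsilon> = \<epsilon>])
    case zero
    then show ?thesis using less.prems by (simp add: leD)
  next
    case (successor \<gamma>)
    then have "\<alpha> \<le> \<gamma>" using less.prems by simp
    then consider "\<alpha> = \<gamma>" | "\<alpha> < \<gamma>" by fastforce
    then show ?thesis
    proof cases
      case 2
      have "cb_derivative X d \<epsilon> (cb_stage X d \<epsilon> \<gamma>) \<subseteq> cb_stage X d \<epsilon> \<gamma>" by (rule cb_derivative_subset)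
      also have "\<dots> \<subseteq> cb_derivative X d \<epsilon> (cb_stage X d \<epsilon> \<alpha>)"
        using less.IH[OF successor(1) 2] .
      finally show ?thesis by (simp add: successor(3))
    qed (simp add: successor(3))
  next
    case limit
    then obtain \<gamma> where \<gamma>: "\<alpha> < \<gamma>" "\<gamma> < \<beta>" using less.prems by blast
    then have "cb_stage X d \<epsilon> \<beta> \<subseteq> cb_stage X d \<epsilon> \<gamma>" by (auto simp: limit(3))
    with less.IH[OF \<gamma>(2,1)] show ?thesis by blast
  qed
qed

definition eps_perfect :: "'z topology \<Rightarrow> ('z \<Rightarrow> 'z \<Rightarrow> real) \<Rightarrow> real \<Rightarrow> 'z set \<Rightarrow> bool" where
  "eps_perfect X d \<epsilon> P \<longleftrightarrow>
     closedin X P \<and> (\<forall>U. openin (subtopology X P) U \<longrightarrow> eps_finite d \<epsilon> U \<longrightarrow> U = {})"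

lemma eps_finite_subset: "eps_finite d \<epsilon> A \<Longrightarrow> B \<subseteq> A \<Longrightarrow> eps_finite d \<epsilon> B"
  unfolding eps_finite_def by (meson subsetD)

text \<open>
  A relatively open \<open>\<epsilon>\<close>-finite subset of a stage that contains \<open>P\<close> cuts out such a subset of \<open>P\<close>,
  which is empty.
\<close>

lemma eps_perfect_subset_cb_stage:
  assumes "eps_perfect X d \<epsilon> P"
  shows "P \<subseteq> cb_stage X d \<epsilon> \<alpha>"
proof (induction \<alpha> rule: less_induct)
  case (less \<alpha>)
  show ?case
  proof (cases rule: cb_stage_cases[where \<alpha> = \<alpha> and X = X and d = d and \<epsilon> = \<epsilon>])
    case zero
    then show ?thesis using assms by (simp add: eps_perfect_def closedin_subset)
  next
    case (successor \<beta>)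
    let ?Z = "cb_stage X d \<epsilon> \<beta>"
    have PZ: "P \<subseteq> ?Z" using less successor(1) .
    have "P \<inter> U = {}" if U: "openin (subtopology X ?Z) U" "eps_finite d \<epsilon> U" for U
    proof -
      obtain V where V: "openin X V" "U = V \<inter> ?Z" using U(1) by (auto simp: openin_subtopology)
      then have "P \<inter> U = V \<inter> P" using PZ by auto
      then have "openin (subtopology X P) (P \<inter> U)" using V(1) by (auto simp: openin_subtopology)
      moreover have "eps_finite d \<epsilon> (P \<inter> U)" using U(2) by (rule eps_finite_subset) auto
      ultimately show ?thesis using assms by (simp add: eps_perfect_def)
    qed
    then show ?thesis using PZ by (auto simp: successor(3) cb_derivative_def)
  next
    case limit
    then show ?thesis using less by auto
  qed
qed

text \<open>
  If every stage lost a point on taking the derivative, choosing such points would give an injection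
  of the ordinals into the points.  So some stage equals its derivative, and it is perfect.
\<close>

lemma CB_rank_Infinity_iff:
  "CB_rank X d \<epsilon> A = Infinity \<longleftrightarrow> (\<exists>P. eps_perfect X d \<epsilon> P \<and> P \<inter> A \<noteq> {})"
proof
  assume "\<exists>P. eps_perfect X d \<epsilon> P \<and> P \<inter> A \<noteq> {}"
  then obtain P where "eps_perfect X d \<epsilon> P" "P \<inter> A \<noteq> {}" by blast
  then have "\<forall>\<alpha> :: 'a ordinal. cb_stage X d \<epsilon> \<alpha> \<inter> A \<noteq> {}"
    using eps_perfect_subset_cb_stage[of X d \<epsilon> P] by blast
  then show "CB_rank X d \<epsilon> A = Infinity" by (simp add: CB_rank_def)
next
  assume "CB_rank X d \<epsilon> A = Infinity"
  then have ne: "cb_stage X d \<epsilon> \<alpha> \<inter> A \<noteq> {}" for \<alpha> :: "'a ordinal"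
    by (auto simp: CB_rank_def split: if_splits)
  have "\<exists>\<alpha> :: 'a ordinal. cb_derivative X d \<epsilon> (cb_stage X d \<epsilon> \<alpha>) = cb_stage X d \<epsilon> \<alpha>"
  proof (rule ccontr)
    assume "\<not> ?thesis"
    then have "\<exists>x. x \<in> cb_stage X d \<epsilon> \<alpha> \<and> x \<notin> cb_derivative X d \<epsilon> (cb_stage X d \<epsilon> \<alpha>)" for \<alpha> :: "'a ordinal"
      using cb_derivative_subset[of X d \<epsilon> "cb_stage X d \<epsilon> \<alpha>"] by blast
    then obtain g where g: "\<And>\<alpha> :: 'a ordinal. g \<alpha> \<in> cb_stage X d \<epsilon> \<alpha> \<and>
        g \<alpha> \<notin> cb_derivative X d \<epsilon> (cb_stage X d \<epsilon> \<alpha>)" by metis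
    have "g \<alpha> \<noteq> g \<beta>" if "\<alpha> < \<beta>" for \<alpha> \<beta>
      using g[of \<alpha>] g[of \<beta>] cb_stage_decreasing[OF that, of X d \<epsilon>] by auto
    then have "inj g" by (metis injI linorder_neqE)
    then show False using no_injection_of_ordinals by blast
  qed
  then obtain \<alpha> :: "'a ordinal" where \<alpha>: "cb_derivative X d \<epsilon> (cb_stage X d \<epsilon> \<alpha>) = cb_stage X d \<epsilon> \<alpha>" ..
  let ?P = "cb_stage X d \<epsilon> \<alpha>"
  have "U = {}" if "openin (subtopology X ?P) U" "eps_finite d \<epsilon> U" for U
  proof -
    have "U \<inter> cb_derivative X d \<epsilon> ?P = {}" using that by (auto simp: cb_derivative_def)
    moreover have "U \<subseteq> ?P" using openin_subset[OF that(1)] by simp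
    ultimately show ?thesis unfolding \<alpha> by blast
  qed
  then have "eps_perfect X d \<epsilon> ?P" by (auto simp: eps_perfect_def cb_stage_closed)
  with ne show "\<exists>P. eps_perfect X d \<epsilon> P \<and> P \<inter> A \<noteq> {}" by blast
qed

section \<open>Perfect sets and large sets of separated points\<close>

text \<open>
  The perfect set is a minimal closed \<open>P\<close> for which \<open>f ` P\<close> contains all but countably many points
  of \<open>W\<close>.  Minimal sets exist by Zorn's lemma: by compactness of the fibres, a point outside the
  image of the intersection of a chain is already outside the image of a member, together with a
  basic neighbourhood, and the base is countable.  Removing a non-empty relatively open \<open>V\<close> from
  \<open>P\<close> loses uncountably many points of \<open>W\<close>, so \<open>V\<close> contains infinitely many separated points.
\<close>

lemma uncountable_separated_gives_perfect:
  assumes X: "compact_space X" and Y: "Hausdorff_space Y" "second_countable Y"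
    and f: "continuous_map X Y f" and W: "W \<subseteq> f ` topspace X" "uncountable W"
    and sep: "\<And>u v. u \<in> topspace X \<Longrightarrow> v \<in> topspace X \<Longrightarrow> f u \<in> W \<Longrightarrow> f v \<in> W \<Longrightarrow> f u \<noteq> f v \<Longrightarrow> d u v > \<epsilon>"
  shows "\<exists>P. eps_perfect X d \<epsilon> P \<and> P \<noteq> {}"
proof -
  obtain \<B> where \<B>: "countable \<B>" and base: "\<And>U x. openin Y U \<Longrightarrow> x \<in> U \<Longrightarrow> \<exists>B\<in>\<B>. x \<in> B \<and> B \<subseteq> U"
    using Y(2) unfolding second_countable_def by (elim exE conjE) (meson)
  have closed: "closedin Y (f ` C)" if "closedin X C" for C
    using continuous_imp_closed_map[OF f X Y(1)] that by (simp add: closed_map_def)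
  \<comment> \<open>Passing to complements turns the minimal closed set into a maximal open one.\<close>
  define \<U> where "\<U> = {U. openin X U \<and> countable (W - f ` (topspace X - U))}"
  have "\<exists>U\<in>\<U>. \<forall>V\<in>\<U>. U \<subseteq> V \<longrightarrow> V = U"
  proof (rule subset_Zorn_nonempty)
    have "{} \<in> \<U>" using W(1) by (simp add: \<U>_def Diff_eq_empty_iff[THEN iffD2])
    then show "\<U> \<noteq> {}" by blast
  next
    fix \<C> assume ne: "\<C> \<noteq> {}" and chain: "subset.chain \<U> \<C>"
    then have \<C>: "\<And>U. U \<in> \<C> \<Longrightarrow> openin X U \<and> countable (W - f ` (topspace X - U))"
      by (auto simp: subset.chain_def \<U>_def)
    have "W - f ` (topspace X - \<Union>\<C>) \<subseteq> (\<Union>B\<in>{B \<in> \<B>. countable (B \<inter> W)}. B \<inter> W)"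
    proof
      fix w assume w: "w \<in> W - f ` (topspace X - \<Union>\<C>)"
      have wY: "w \<in> topspace Y" using w W(1) f by (auto simp: continuous_map_def)
      let ?F = "{x \<in> topspace X. f x \<in> {w}}"
      have "closedin X ?F"
        using f closedin_Hausdorff_singleton[OF Y(1) wY] by (rule closedin_continuous_map_preimage)
      then have F: "compactin X ?F" using X by (intro closedin_compact_space)
      have cover: "?F \<subseteq> \<Union>\<C>" using w by auto
      obtain \<F> where \<F>: "finite \<F>" "\<F> \<subseteq> \<C>" "?F \<subseteq> \<Union>\<F>"
        using compactinD[OF F _ cover] \<C> by (elim meta_impE exE conjE) auto
      have "\<exists>U\<in>\<C>. ?F \<subseteq> U"
      proof (cases "\<F> = {}")
        case False
        have "subset.chain \<U> \<F>"
          using chain \<F>(2) unfolding subset.chain_def by (meson subsetD subset_trans)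
        then have "\<Union>\<F> \<in> \<F>"
          using \<F>(1) False by (intro Union_in_chain)
        then show ?thesis using \<F> by blast
      qed (use \<F> ne in auto)
      then obtain U where U: "U \<in> \<C>" "?F \<subseteq> U" by blast
      let ?V = "topspace Y - f ` (topspace X - U)"
      have "openin Y ?V" using closed[of "topspace X - U"] \<C>[OF U(1)] by (simp add: openin_diff closedin_diff)
      moreover have "w \<in> ?V" using U(2) wY by auto
      ultimately obtain B where B: "B \<in> \<B>" "w \<in> B" "B \<subseteq> ?V" using base by blast
      have "B \<inter> W \<subseteq> W - f ` (topspace X - U)" using B(3) by auto
      then have "countable (B \<inter> W)" using \<C>[OF U(1)] countable_subset by blast
      then show "w \<in> (\<Union>B\<in>{B \<in> \<B>. countable (B \<inter> W)}. B \<inter> W)" using B w by blast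
    qed
    moreover have "countable (\<Union>B\<in>{B \<in> \<B>. countable (B \<inter> W)}. B \<inter> W)"
      using \<B> by (intro countable_UN) (auto intro: countable_subset)
    ultimately have "countable (W - f ` (topspace X - \<Union>\<C>))" by (rule countable_subset)
    then show "\<Union>\<C> \<in> \<U>" using \<C> by (auto simp: \<U>_def)
  qed
  then obtain U where U: "U \<in> \<U>" and maximal: "\<And>V. V \<in> \<U> \<Longrightarrow> U \<subseteq> V \<Longrightarrow> V = U" by blast
  define P where "P = topspace X - U"
  have Ucount: "openin X U" "countable (W - f ` P)" using U by (auto simp: \<U>_def P_def)
  have "V = {}" if V: "openin (subtopology X P) V" "eps_finite d \<epsilon> V" for V
  proof (rule ccontr)
    assume "V \<noteq> {}"
    obtain T where T: "openin X T" "V = T \<inter> P" using V(1) by (auto simp: openin_subtopology)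
    have "U \<union> T \<notin> \<U>"
    proof
      assume "U \<union> T \<in> \<U>"
      then have "U \<union> T = U" by (rule maximal) auto
      then show False using T(2) \<open>V \<noteq> {}\<close> by (auto simp: P_def)
    qed
    then have "uncountable (W - f ` (topspace X - (U \<union> T)))"
      using openin_Un[OF Ucount(1) T(1)] by (simp add: \<U>_def)
    then have "uncountable ((W - f ` (topspace X - (U \<union> T))) - (W - f ` P))"
      using Ucount(2) by (rule uncountable_minus_countable)
    moreover have "(W - f ` (topspace X - (U \<union> T))) - (W - f ` P) \<subseteq> W \<inter> f ` V"
      unfolding T(2) P_def by auto
    ultimately have "infinite (W \<inter> f ` V)"
      by (meson countable_finite countable_subset)
    then obtain g :: "nat \<Rightarrow> _" where g: "inj g" "range g \<subseteq> W \<inter> f ` V"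
      using infinite_countable_subset by blast
    have "\<forall>i. \<exists>u\<in>V. f u = g i"
    proof
      fix i
      have "g i \<in> f ` V" using g(2) by auto
      then show "\<exists>u\<in>V. f u = g i" by auto
    qed
    then obtain u where u: "\<And>i. u i \<in> V" "\<And>i. f (u i) = g i" by metis
    have "u i \<in> topspace X" for i using u(1)[of i] T(2) by (auto simp: P_def)
    then have "d (u i) (u j) > \<epsilon>" if "i < j" for i j
      using that g u(2) by (intro sep) (auto simp: inj_eq)
    then show False using V(2) u(1) unfolding eps_finite_def by blast
  qed
  then have "eps_perfect X d \<epsilon> P" using Ucount(1) by (auto simp: eps_perfect_def P_def)
  moreover have "P \<noteq> {}" using Ucount(2) W(2) by auto
  ultimately show ?thesis by blast
qed

text \<open>
  The branch through the binary tree given by \<open>x :: nat set\<close> goes to the left at the levels in \<open>x\<close>.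
  Two branches separate at the first level at which they differ.  The points on the branches exist
  by compactness.
\<close>

lemma cantor_scheme:
  assumes X: "compact_space X" and Q0: "Q C\<^sub>0"
    and closed: "\<And>C. Q C \<Longrightarrow> closedin X C \<and> C \<noteq> {}"
    and split: "\<And>C. Q C \<Longrightarrow> \<exists>D E. Q D \<and> Q E \<and> D \<subseteq> C \<and> E \<subseteq> C \<and> sep D E"
  shows "\<exists>\<T> (f :: nat set \<Rightarrow> 'z). countable \<T> \<and> (\<forall>C\<in>\<T>. Q C) \<and>
    (\<forall>x y. x \<noteq> y \<longrightarrow> (\<exists>C\<in>\<T>. \<exists>D\<in>\<T>. f x \<in> C \<and> f y \<in> D \<and> (sep C D \<or> sep D C)))"
proof -
  have "\<forall>C. \<exists>D E. Q C \<longrightarrow> Q D \<and> Q E \<and> D \<subseteq> C \<and> E \<subseteq> C \<and> sep D E"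
    using split by blast
  then obtain l r where lr: "\<And>C. Q C \<Longrightarrow> Q (l C) \<and> Q (r C) \<and> l C \<subseteq> C \<and> r C \<subseteq> C \<and> sep (l C) (r C)"
    by metis
  \<comment> \<open>The nodes \<open>T s\<close>, with the most recent turn at the head of \<open>s\<close>, and the branches \<open>S x\<close>.\<close>
  define T where "T = (\<lambda>s. foldr (\<lambda>b C. if b then l C else r C) s C\<^sub>0)"
  define S where "S x = rec_nat C\<^sub>0 (\<lambda>k C. if k \<in> x then l C else r C)" for x :: "nat set"
  have S: "S x 0 = C\<^sub>0" "S x (Suc k) = (if k \<in> x then l (S x k) else r (S x k))" for x k
    by (auto simp: S_def)
  have Q: "Q (S x k)" for x k
    by (induction k) (use lr Q0 in \<open>auto simp: S\<close>)
  have in_range: "S x k \<in> range T" for x k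
  proof (induction k)
    case 0
    have "S x 0 = T []" by (simp add: S T_def)
    then show ?case by blast
  next
    case (Suc k)
    then obtain s where "S x k = T s" by auto
    then have "S x (Suc k) = T ((k \<in> x) # s)" by (simp add: S T_def)
    then show ?case by blast
  qed
  have "countable (range T)" by simp
  moreover have "range (\<lambda>(x, k). S x k) \<subseteq> range T"
    unfolding image_subset_iff using in_range by (simp add: split_beta del: image_iff)
  ultimately have count: "countable (range (\<lambda>(x, k). S x k))" by (rule countable_subset[rotated])
  have "decseq (S x)" for x
    by (rule decseq_SucI) (use lr[OF Q] in \<open>simp add: S\<close>)
  then have "(\<Inter>k. S x k) \<noteq> {}" for x
    using X closed[OF Q] by (intro compact_space_imp_nest[of X]) auto
  then have "\<forall>x. \<exists>p. \<forall>k. p \<in> S x k" by blast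
  then obtain f where f: "\<And>x k. f x \<in> S x k" by metis
  have agree: "S x k = S y k" if "\<And>i. i < k \<Longrightarrow> i \<in> x \<longleftrightarrow> i \<in> y" for x y k
    using that by (induction k) (auto simp: S)
  have sep: "\<exists>k. sep (S x k) (S y k) \<or> sep (S y k) (S x k)"
    if "x \<noteq> y" for x y
  proof -
    have ex: "\<exists>k. (k \<in> x) \<noteq> (k \<in> y)" using that by auto
    define k where "k = (LEAST k. (k \<in> x) \<noteq> (k \<in> y))"
    have k: "(k \<in> x) \<noteq> (k \<in> y)" unfolding k_def using ex by (rule LeastI_ex)
    have "i \<in> x \<longleftrightarrow> i \<in> y" if "i < k" for i
      using not_less_Least[of i "\<lambda>k. (k \<in> x) \<noteq> (k \<in> y)"] that by (auto simp: k_def)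
    then have "S x k = S y k" by (rule agree)
    then have "sep (S x (Suc k)) (S y (Suc k)) \<or> sep (S y (Suc k)) (S x (Suc k))"
      using lr[OF Q[of y k]] k by (auto simp: S)
    then show ?thesis by blast
  qed
  have "\<exists>C\<in>range (\<lambda>(x, k). S x k). \<exists>D\<in>range (\<lambda>(x, k). S x k).
      f x \<in> C \<and> f y \<in> D \<and> (sep C D \<or> sep D C)" if "x \<noteq> y" for x y
  proof -
    obtain k where k: "sep (S x k) (S y k) \<or> sep (S y k) (S x k)" using sep[OF \<open>x \<noteq> y\<close>] ..
    have "S x k \<in> range (\<lambda>(x, k). S x k)" "S y k \<in> range (\<lambda>(x, k). S x k)"
      by (rule image_eqI[of _ _ "(x, k)"], simp_all) (rule image_eqI[of _ _ "(y, k)"], simp_all)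
    with k f show ?thesis by (intro bexI[of _ "S x k"] bexI[of _ "S y k"]) auto
  qed
  with count Q show ?thesis
    by (intro exI[of _ "range (\<lambda>(x, k). S x k)"] exI[of _ f] conjI) (simp_all add: split_beta)
qed

lemma uncountable_nat_sets: "uncountable (UNIV :: nat set set)"
proof
  assume "countable (UNIV :: nat set set)"
  then obtain f :: "nat \<Rightarrow> nat set" where "range f = UNIV"
    by (metis UNIV_not_empty uncountable_def)
  then show False using Cantors_theorem[of "UNIV :: nat set"] by (auto simp: Pow_UNIV)
qed

section \<open>Stability and rank\<close>

lemma saturated_extension_over:
  assumes "saturated_extension L M N" "A \<subseteq> univ M"
  shows "saturated_over L N A"
proof -
  have N: "is_structure L N" "univ M \<subseteq> univ N" "saturated L (cardSuc (card_of (univ M))) N"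
    using assms(1) by (auto simp: saturated_extension_def elementary_extension_def)
  have "(card_of A, card_of (univ M)) \<in> ordLeq" using assms(2) by (rule card_of_mono1)
  then have "small (cardSuc (card_of (univ M))) A"
    unfolding small_def by (rule ordLeq_ordLess_trans) (rule cardSuc_greater[OF card_of_Card_order])
  moreover have "A \<subseteq> univ N" using assms(2) N(2) by (rule subset_trans)
  ultimately show ?thesis
    using N(1,3) unfolding saturated_def by unfold_locales auto
qed

text \<open>
  If all separated sets are countable, maximal ones for \<open>\<epsilon> = 1, 1/2, 1/3, \<dots>\<close> unite to a countable
  dense set.
\<close>

lemma (in structure_with_parameters) uncountable_separated_types:
  assumes "\<nexists>D. D \<subseteq> type_space L N n A \<and> countable D \<and>
    (\<forall>p\<in>type_space L N n A. \<forall>\<epsilon>>0. \<exists>q\<in>D. type_dist L N n A p q < \<epsilon>)"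
  shows "\<exists>\<epsilon>>0. \<exists>W\<subseteq>type_space L N n A. uncountable W \<and>
    (\<forall>p\<in>W. \<forall>q\<in>W. p \<noteq> q \<longrightarrow> \<epsilon> < type_dist L N n A p q)"
proof (rule ccontr)
  assume contra: "\<not> ?thesis"
  let ?S = "type_space L N n A" and ?d = "type_dist L N n A"
  define sep where "sep \<epsilon> W \<longleftrightarrow> W \<subseteq> ?S \<and> (\<forall>p\<in>W. \<forall>q\<in>W. p \<noteq> q \<longrightarrow> \<epsilon> < ?d p q)" for \<epsilon> W
  have countable: "countable W" if "sep \<epsilon> W" "\<epsilon> > 0" for \<epsilon> W
  proof (rule ccontr)
    assume "uncountable W"
    then have "0 < \<epsilon> \<and> (\<exists>W\<subseteq>?S. uncountable W \<and> (\<forall>p\<in>W. \<forall>q\<in>W. p \<noteq> q \<longrightarrow> \<epsilon> < ?d p q))"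
      using that unfolding sep_def by (intro conjI exI[of _ W]) simp_all
    then have "\<exists>\<epsilon>>0. \<exists>W\<subseteq>?S. uncountable W \<and> (\<forall>p\<in>W. \<forall>q\<in>W. p \<noteq> q \<longrightarrow> \<epsilon> < ?d p q)"
      by (rule exI)
    with contra show False by (rule notE)
  qed
  have "\<exists>W. sep \<epsilon> W \<and> (\<forall>W'. sep \<epsilon> W' \<longrightarrow> W \<subseteq> W' \<longrightarrow> W' = W)" for \<epsilon>
  proof -
    have "\<exists>W\<in>Collect (sep \<epsilon>). \<forall>W'\<in>Collect (sep \<epsilon>). W \<subseteq> W' \<longrightarrow> W' = W"
    proof (rule subset_Zorn')
      fix \<C> assume chain: "subset.chain (Collect (sep \<epsilon>)) \<C>"
      have \<C>: "sep \<epsilon> W" if "W \<in> \<C>" for W using chain that by (auto simp: subset.chain_def)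
      have "\<epsilon> < ?d p q" if p: "p \<in> W" "W \<in> \<C>" and q: "q \<in> W'" "W' \<in> \<C>" and "p \<noteq> q" for p q W W'
      proof -
        have "W \<subseteq> W' \<or> W' \<subseteq> W" using chain p q unfolding subset_chain_def by auto
        then have "\<exists>V\<in>\<C>. p \<in> V \<and> q \<in> V" using p q by auto
        then show ?thesis using \<C> \<open>p \<noteq> q\<close> unfolding sep_def by auto
      qed
      moreover have "\<Union>\<C> \<subseteq> ?S" using \<C> unfolding sep_def by auto
      ultimately show "\<Union>\<C> \<in> Collect (sep \<epsilon>)" unfolding sep_def by auto
    qed
    then show ?thesis by auto
  qed
  then obtain W where W: "\<And>\<epsilon>. sep \<epsilon> (W \<epsilon>)" and maximal: "\<And>\<epsilon> W'. sep \<epsilon> W' \<Longrightarrow> W \<epsilon> \<subseteq> W' \<Longrightarrow> W' = W \<epsilon>"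
    by metis
  define D where "D = (\<Union>k. W (1 / Suc k))"
  have "D \<subseteq> ?S" using W by (auto simp: D_def sep_def)
  moreover have "countable D" unfolding D_def using countable[OF W] by simp
  moreover have "\<exists>q\<in>D. ?d p q < \<epsilon>" if p: "p \<in> ?S" and \<epsilon>: "\<epsilon> > 0" for p \<epsilon>
  proof (rule ccontr)
    assume "\<not> (\<exists>q\<in>D. ?d p q < \<epsilon>)"
    then have far: "\<epsilon> \<le> ?d p q" if "q \<in> D" for q using that by (auto simp: not_less)
    obtain k where k: "1 / Suc k < \<epsilon>" using nat_approx_posE[OF \<epsilon>] by auto
    let ?W = "W (1 / Suc k)"
    have WD: "?W \<subseteq> D" by (auto simp: D_def)
    have less: "1 / Suc k < ?d p q" if "q \<in> ?W" for q
    proof -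
      have "\<epsilon> \<le> ?d p q" using that WD by (intro far) auto
      with k show ?thesis by (rule less_le_trans)
    qed
    moreover have "1 / Suc k < ?d q p" if "q \<in> ?W" for q
    proof -
      have "q \<in> ?S" using that W[of "1 / Suc k"] by (auto simp: sep_def)
      then show ?thesis using less[OF that] type_dist_commute[OF p, of q] by simp
    qed
    ultimately have "sep (1 / Suc k) (insert p ?W)"
      using W[of "1 / Suc k"] p by (simp add: sep_def)
    then have "insert p ?W = ?W" by (rule maximal) auto
    then have "p \<in> D" using WD by auto
    with far[of p] type_dist_refl[OF p] \<epsilon> show False by simp
  qed
  ultimately have "\<exists>D. D \<subseteq> ?S \<and> countable D \<and> (\<forall>p\<in>?S. \<forall>\<epsilon>>0. \<exists>q\<in>D. ?d p q < \<epsilon>)"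
    by (intro exI[of _ D] conjI ballI allI impI)
  with assms show False by (rule notE)
qed

text \<open>
  Uncountably many separated types over a countable set of parameters lie in a second countable
  space, and restricting types to these parameters does not increase distances.
\<close>

lemma not_separable_gives_perfect:
  assumes A: "structure_with_parameters L N A" and B: "saturated_over L N B" and "A \<subseteq> B"
    and countable: "countable_signature L" "countable A"
    and notsep: "\<nexists>D. D \<subseteq> type_space L N n A \<and> countable D \<and>
      (\<forall>p\<in>type_space L N n A. \<forall>\<epsilon>>0. \<exists>q\<in>D. type_dist L N n A p q < \<epsilon>)"
  shows "\<exists>\<epsilon>>0. \<exists>P. eps_perfect (logic_topology L N n B) (type_dist L N n B) \<epsilon> P \<and> P \<noteq> {}"
proof -
  obtain \<epsilon> W where \<epsilon>: "\<epsilon> > 0" and W: "W \<subseteq> type_space L N n A" "uncountable W"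
    and sep: "\<And>p q. p \<in> W \<Longrightarrow> q \<in> W \<Longrightarrow> p \<noteq> q \<Longrightarrow> \<epsilon> < type_dist L N n A p q"
    using structure_with_parameters.uncountable_separated_types[OF A notsep] by blast
  have "\<exists>P. eps_perfect (logic_topology L N n B) (type_dist L N n B) \<epsilon> P \<and> P \<noteq> {}"
  proof (rule uncountable_separated_gives_perfect[where W = W])
    show "compact_space (logic_topology L N n B)"
      using B by (rule saturated_over.compact_logic_topology)
    show "Hausdorff_space (logic_topology L N n A)" by (rule Hausdorff_logic_topology)
    show "second_countable (logic_topology L N n A)"
      using countable by (intro second_countable_logic_topology countable_formulas)
    show "continuous_map (logic_topology L N n B) (logic_topology L N n A) (\<lambda>p. restrict p (formulas L n A))"
      using \<open>A \<subseteq> B\<close> by (rule continuous_restrict)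
    show "W \<subseteq> (\<lambda>p. restrict p (formulas L n A)) ` topspace (logic_topology L N n B)"
      using W(1) \<open>A \<subseteq> B\<close> by (simp add: topspace_logic_topology restrict_type_space)
    show "\<epsilon> < type_dist L N n B u v"
      if "u \<in> topspace (logic_topology L N n B)" "v \<in> topspace (logic_topology L N n B)"
        "restrict u (formulas L n A) \<in> W" "restrict v (formulas L n A) \<in> W"
        "restrict u (formulas L n A) \<noteq> restrict v (formulas L n A)" for u v
      using sep[OF that(3-5)] type_dist_restrict_le[OF \<open>A \<subseteq> B\<close>, of u L N n v] that(1,2)
      by (simp add: topspace_logic_topology)
  qed (rule W)
  with \<epsilon> show ?thesis by blast
qed

text \<open>
  The nodes of the tree: closed neighbourhoods of points of \<open>P\<close> that are unions of fibres of the
  restriction to finitely many parameters.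
\<close>

definition definable_neighbourhood ::
  "('f, 'p) signature \<Rightarrow> ('f, 'p, 'm) cstructure \<Rightarrow> nat \<Rightarrow> 'm set \<Rightarrow>
    (('f, 'p, 'm) fml \<Rightarrow> real) set \<Rightarrow> (('f, 'p, 'm) fml \<Rightarrow> real) set \<Rightarrow> bool" where
  "definable_neighbourhood L N n A P C \<longleftrightarrow>
     closedin (logic_topology L N n A) C \<and> logic_topology L N n A interior_of C \<inter> P \<noteq> {} \<and>
     (\<exists>A\<^sub>0\<subseteq>A. finite A\<^sub>0 \<and> (\<forall>p\<in>C. \<forall>q\<in>topspace (logic_topology L N n A).
        (\<forall>\<phi>\<in>formulas L n A\<^sub>0. p \<phi> = q \<phi>) \<longrightarrow> q \<in> C))"

text \<open>
  The interior of \<open>C\<close> contains points \<open>p\<close> and \<open>q\<close> of \<open>P\<close> at distance greater than \<open>\<epsilon>\<close>, since it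
  meets \<open>P\<close> in a set that is not \<open>\<epsilon>\<close>-finite.  Lower semicontinuity provides finitely many formulas
  that keep neighbourhoods of \<open>p\<close> and \<open>q\<close> apart.
\<close>

lemma (in saturated_over) perfect_splits:
  assumes P: "eps_perfect (logic_topology L N n A) (type_dist L N n A) \<epsilon> P"
    and C: "definable_neighbourhood L N n A P C"
  shows "\<exists>D E. definable_neighbourhood L N n A P D \<and> definable_neighbourhood L N n A P E \<and>
    D \<subseteq> C \<and> E \<subseteq> C \<and> (\<forall>u\<in>D. \<forall>v\<in>E. \<epsilon> < type_dist L N n A u v)"
proof -
  let ?d = "type_dist L N n A"
  define X where "X = logic_topology L N n A"
  have top: "topspace X = type_space L N n A" by (simp add: X_def topspace_logic_topology)
  note Q_def = definable_neighbourhood_def[of L N n A P, folded X_def]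
  have "\<exists>A\<^sub>0\<subseteq>A. finite A\<^sub>0 \<and> (\<forall>p\<in>C. \<forall>q\<in>topspace X. (\<forall>\<phi>\<in>formulas L n A\<^sub>0. p \<phi> = q \<phi>) \<longrightarrow> q \<in> C)"
    using C unfolding Q_def by (elim conjE)
  then obtain A\<^sub>0 where A\<^sub>0: "A\<^sub>0 \<subseteq> A" "finite A\<^sub>0"
    and det: "\<forall>p\<in>C. \<forall>q\<in>topspace X. (\<forall>\<phi>\<in>formulas L n A\<^sub>0. p \<phi> = q \<phi>) \<longrightarrow> q \<in> C"
    by (elim exE conjE)
  have closed: "closedin X C" and ne: "X interior_of C \<inter> P \<noteq> {}" using C by (auto simp: Q_def)
  have "openin (subtopology X P) (X interior_of C \<inter> P)"
    by (rule openin_subtopology_Int[OF openin_interior_of])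
  then have "\<not> eps_finite ?d \<epsilon> (X interior_of C \<inter> P)"
    using P ne by (auto simp: eps_perfect_def X_def[symmetric])
  then obtain a :: "nat \<Rightarrow> _" where "\<forall>i\<le>1. a i \<in> X interior_of C \<inter> P" "\<forall>j\<le>1. \<forall>i<j. \<epsilon> < ?d (a i) (a j)"
    unfolding eps_finite_def by blast
  then obtain p q where p: "p \<in> X interior_of C \<inter> P" and q: "q \<in> X interior_of C \<inter> P" and pq: "\<epsilon> < ?d p q"
    by (metis le_numeral_extra(4) less_one zero_le)
  have "p \<in> type_space L N n A" "q \<in> type_space L N n A"
    using p q interior_of_subset_topspace[of X C] top by auto
  from type_dist_lower_semicontinuous[OF this pq] obtain F \<delta> where
    F: "finite F" "F \<subseteq> formulas L n A" and \<delta>: "\<delta> > 0" and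
    sep: "\<forall>u\<in>topspace X. \<forall>v\<in>topspace X. (\<forall>\<phi>\<in>F. \<bar>u \<phi> - p \<phi>\<bar> < \<delta> \<and> \<bar>v \<phi> - q \<phi>\<bar> < \<delta>) \<longrightarrow> \<epsilon> < ?d u v"
    unfolding top by (elim exE conjE)
  obtain A\<^sub>1 where A\<^sub>1: "A\<^sub>1 \<subseteq> A" "finite A\<^sub>1" "F \<subseteq> formulas L n A\<^sub>1"
    using formulas_support[OF F] by (elim exE conjE)
  \<comment> \<open>The weak inequalities with \<open>\<delta> / 2\<close> make the sets closed and imply the strict ones with \<open>\<delta>\<close>.\<close>
  define nbhd where "nbhd r = C \<inter> {u \<in> topspace X. \<forall>\<phi>\<in>F. \<bar>u \<phi> - r \<phi>\<bar> \<le> \<delta> / 2}" for r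
  have cont: "continuous_map X euclideanreal (\<lambda>u. u \<phi>)" if "\<phi> \<in> F" for \<phi>
    unfolding X_def using that F(2) by (intro continuous_evaluation) auto
  have Q: "definable_neighbourhood L N n A P (nbhd r)" if r: "r \<in> X interior_of C \<inter> P" for r
    unfolding Q_def
  proof (intro conjI)
    show "closedin X (nbhd r)"
      unfolding nbhd_def using closed F(1) cont
      by (intro closedin_Int closedin_finitely_many_conditions)
    have "openin X (X interior_of C \<inter> {u \<in> topspace X. \<forall>\<phi>\<in>F. \<bar>u \<phi> - r \<phi>\<bar> < \<delta> / 2})"
      using F(1) cont by (intro openin_Int openin_interior_of openin_finitely_many_conditions)
    moreover have "X interior_of C \<inter> {u \<in> topspace X. \<forall>\<phi>\<in>F. \<bar>u \<phi> - r \<phi>\<bar> < \<delta> / 2} \<subseteq> nbhd r"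
      using interior_of_subset[of X C] by (auto simp: nbhd_def)
    moreover have "r \<in> X interior_of C \<inter> {u \<in> topspace X. \<forall>\<phi>\<in>F. \<bar>u \<phi> - r \<phi>\<bar> < \<delta> / 2}"
      using r interior_of_subset_topspace[of X C] \<delta> by auto
    ultimately have "r \<in> X interior_of nbhd r" unfolding interior_of_def by blast
    with r show "X interior_of nbhd r \<inter> P \<noteq> {}" by blast
    have "q \<in> nbhd r" if pq: "p \<in> nbhd r" "q \<in> topspace X" "\<forall>\<phi>\<in>formulas L n (A\<^sub>0 \<union> A\<^sub>1). p \<phi> = q \<phi>" for p q
    proof -
      have "formulas L n A\<^sub>0 \<subseteq> formulas L n (A\<^sub>0 \<union> A\<^sub>1)" "formulas L n A\<^sub>1 \<subseteq> formulas L n (A\<^sub>0 \<union> A\<^sub>1)"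
        by (intro formulas_mono; simp)+
      then have eq: "p \<phi> = q \<phi>" if "\<phi> \<in> formulas L n A\<^sub>0 \<or> \<phi> \<in> F" for \<phi>
        using that pq(3) A\<^sub>1(3) by (meson subsetD)
      have "q \<in> C" using bspec[OF bspec[OF det, of p], of q] pq(1,2) eq by (simp add: nbhd_def)
      then show ?thesis using pq(1,2) eq by (simp add: nbhd_def)
    qed
    then show "\<exists>A\<^sub>0\<subseteq>A. finite A\<^sub>0 \<and> (\<forall>p\<in>nbhd r. \<forall>q\<in>topspace X. (\<forall>\<phi>\<in>formulas L n A\<^sub>0. p \<phi> = q \<phi>) \<longrightarrow> q \<in> nbhd r)"
      using A\<^sub>0 A\<^sub>1 by (intro exI[of _ "A\<^sub>0 \<union> A\<^sub>1"]) simp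
  qed
  have "\<epsilon> < ?d u v" if "u \<in> nbhd p" "v \<in> nbhd q" for u v
  proof (rule sep[rule_format])
    show "u \<in> topspace X" "v \<in> topspace X" using that by (auto simp: nbhd_def)
    fix \<phi> assume "\<phi> \<in> F"
    then have "\<bar>u \<phi> - p \<phi>\<bar> \<le> \<delta> / 2" "\<bar>v \<phi> - q \<phi>\<bar> \<le> \<delta> / 2" using that by (simp_all add: nbhd_def)
    with \<delta> show "\<bar>u \<phi> - p \<phi>\<bar> < \<delta> \<and> \<bar>v \<phi> - q \<phi>\<bar> < \<delta>" by linarith
  qed
  then show ?thesis
    using Q[OF p] Q[OF q] by (intro exI[of _ "nbhd p"] exI[of _ "nbhd q"] conjI) (auto simp: nbhd_def)
qed

text \<open>
  Types on different branches of the tree over \<open>P\<close> remain at distance at least \<open>\<epsilon>\<close> when restricted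
  to the parameters \<open>A\<close> of the tree, because a realisation of the restriction of a type in a node has
  a type over \<open>B\<close> that is again in this node.
\<close>

lemma perfect_gives_not_separable:
  assumes sat: "\<And>A. A \<subseteq> B \<Longrightarrow> saturated_over L N A" and \<epsilon>: "\<epsilon> > 0"
    and P: "eps_perfect (logic_topology L N n B) (type_dist L N n B) \<epsilon> P" "P \<noteq> {}"
  shows "\<exists>A\<subseteq>B. countable A \<and> \<not> (\<exists>D\<subseteq>type_space L N n A. countable D \<and>
      (\<forall>p\<in>type_space L N n A. \<forall>\<epsilon>>0. \<exists>q\<in>D. type_dist L N n A p q < \<epsilon>))"
proof -
  interpret B: saturated_over L N B by (rule sat) simp
  define X where "X = logic_topology L N n B"
  define Q where Q: "Q = definable_neighbourhood L N n B P"
  have Q_def: "Q C \<longleftrightarrow> closedin X C \<and> X interior_of C \<inter> P \<noteq> {} \<and>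
    (\<exists>A\<^sub>0\<subseteq>B. finite A\<^sub>0 \<and> (\<forall>p\<in>C. \<forall>q\<in>topspace X. (\<forall>\<phi>\<in>formulas L n A\<^sub>0. p \<phi> = q \<phi>) \<longrightarrow> q \<in> C))" for C
    by (simp add: Q definable_neighbourhood_def X_def)
  have top: "topspace X = type_space L N n B" by (simp add: X_def topspace_logic_topology)
  have "\<exists>\<T> (f :: nat set \<Rightarrow> _). countable \<T> \<and> (\<forall>C\<in>\<T>. Q C) \<and>
    (\<forall>x y. x \<noteq> y \<longrightarrow> (\<exists>C\<in>\<T>. \<exists>D\<in>\<T>. f x \<in> C \<and> f y \<in> D \<and>
      ((\<forall>u\<in>C. \<forall>v\<in>D. \<epsilon> < type_dist L N n B u v) \<or> (\<forall>u\<in>D. \<forall>v\<in>C. \<epsilon> < type_dist L N n B u v))))"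
  proof (rule cantor_scheme)
    show "compact_space X" unfolding X_def by (rule B.compact_logic_topology)
    have "P \<subseteq> topspace X" using P(1) by (simp add: eps_perfect_def X_def closedin_subset)
    then show "Q (topspace X)"
      using P(2) by (auto simp: Q_def interior_of_topspace intro!: exI[of _ "{}"])
    show "closedin X C \<and> C \<noteq> {}" if "Q C" for C
      using that interior_of_subset[of X C] by (auto simp: Q_def)
    show "\<exists>D E. Q D \<and> Q E \<and> D \<subseteq> C \<and> E \<subseteq> C \<and> (\<forall>u\<in>D. \<forall>v\<in>E. \<epsilon> < type_dist L N n B u v)" if "Q C" for C
      using that unfolding Q by (rule B.perfect_splits[OF P(1)])
  qed
  then obtain \<T> and f :: "nat set \<Rightarrow> _" where \<T>: "countable \<T>" "\<forall>C\<in>\<T>. Q C"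
    and f: "\<forall>x y. x \<noteq> y \<longrightarrow> (\<exists>C\<in>\<T>. \<exists>D\<in>\<T>. f x \<in> C \<and> f y \<in> D \<and>
      ((\<forall>u\<in>C. \<forall>v\<in>D. \<epsilon> < type_dist L N n B u v) \<or> (\<forall>u\<in>D. \<forall>v\<in>C. \<epsilon> < type_dist L N n B u v)))"
    by (elim exE conjE)
  have "\<forall>C\<in>\<T>. \<exists>A\<^sub>0\<subseteq>B. finite A\<^sub>0 \<and> (\<forall>p\<in>C. \<forall>q\<in>topspace X. (\<forall>\<phi>\<in>formulas L n A\<^sub>0. p \<phi> = q \<phi>) \<longrightarrow> q \<in> C)"
    using \<T>(2) unfolding Q_def by simp
  then obtain par where par: "\<And>C. C \<in> \<T> \<Longrightarrow> par C \<subseteq> B \<and> finite (par C) \<and>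
      (\<forall>p\<in>C. \<forall>q\<in>topspace X. (\<forall>\<phi>\<in>formulas L n (par C). p \<phi> = q \<phi>) \<longrightarrow> q \<in> C)"
    by metis
  define A where "A = (\<Union>C\<in>\<T>. par C)"
  have AB: "A \<subseteq> B" using par by (auto simp: A_def)
  have "countable A"
    unfolding A_def using \<T>(1) par by (intro countable_UN) (auto intro: countable_finite)
  interpret A: saturated_over L N A using AB by (rule sat)
  let ?d = "type_dist L N n A"
  define g where "g x = restrict (f x) (formulas L n A)" for x
  have CB: "C \<subseteq> type_space L N n B" if "C \<in> \<T>" for C
    using bspec[OF \<T>(2) that] closedin_subset[of X C] by (simp add: Q_def top)
  have fB: "f x \<in> type_space L N n B" for x
  proof -
    obtain y where "x \<noteq> (y :: nat set)" by (metis UNIV_not_empty)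
    from f[rule_format, OF this] show ?thesis using CB by auto
  qed
  have gA: "g x \<in> type_space L N n A" for x
    using fB[of x] restrict_type_space[OF AB, of L n N] unfolding g_def by blast
  have in_C: "type_of L N n B a \<in> C"
    if C: "C \<in> \<T>" "f x \<in> C" and a: "a \<in> tuples N n" "type_of L N n A a = g x" for C x a
  proof -
    have "f x \<phi> = type_of L N n B a \<phi>" if \<phi>: "\<phi> \<in> formulas L n (par C)" for \<phi>
    proof -
      have "par C \<subseteq> A" using \<open>C \<in> \<T>\<close> by (auto simp: A_def)
      then have \<phi>A: "\<phi> \<in> formulas L n A" using \<phi> formulas_mono[of n n "par C" A L] by auto
      then have "\<phi> \<in> formulas L n B" using AB formulas_mono[of n n A B L] by auto
      then show ?thesis using \<phi>A fun_cong[OF a(2), of \<phi>] by (simp add: g_def type_of_apply)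
    qed
    then show ?thesis
      using par[OF C(1)] C(2) type_of_in_type_space[OF a(1), of L B] by (simp add: top)
  qed
  have apart: "\<epsilon> \<le> ?d (g x) (g y)"
    if C: "C \<in> \<T>" "f x \<in> C" and D: "D \<in> \<T>" "f y \<in> D"
      and sep: "\<forall>u\<in>C. \<forall>v\<in>D. \<epsilon> < type_dist L N n B u v" for x y C D
  proof (rule type_dist_greatest[OF gA gA])
    fix a b assume a: "a \<in> tuples N n" "type_of L N n A a = g x" and b: "b \<in> tuples N n" "type_of L N n A b = g y"
    have "\<epsilon> < type_dist L N n B (type_of L N n B a) (type_of L N n B b)"
      using sep in_C[OF C a] in_C[OF D b] by blast
    also have "\<dots> \<le> tuple_dist N n a b" using a(1) b(1) by (rule type_dist_le)
    finally show "\<epsilon> \<le> tuple_dist N n a b" by simp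
  qed
  have far: "\<epsilon> \<le> ?d (g x) (g y)" if "x \<noteq> y" for x y
  proof -
    obtain C D where C: "C \<in> \<T>" "f x \<in> C" and D: "D \<in> \<T>" "f y \<in> D"
      and "(\<forall>u\<in>C. \<forall>v\<in>D. \<epsilon> < type_dist L N n B u v) \<or> (\<forall>u\<in>D. \<forall>v\<in>C. \<epsilon> < type_dist L N n B u v)"
      using f[rule_format, OF \<open>x \<noteq> y\<close>] by (elim bexE conjE)
    then show ?thesis
      using apart[OF C D] apart[OF D C] A.type_dist_commute[OF gA gA, of x y] by auto
  qed
  have "\<not> (\<exists>D\<subseteq>type_space L N n A. countable D \<and> (\<forall>p\<in>type_space L N n A. \<forall>\<epsilon>>0. \<exists>q\<in>D. ?d p q < \<epsilon>))"
  proof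
    assume "\<exists>D\<subseteq>type_space L N n A. countable D \<and> (\<forall>p\<in>type_space L N n A. \<forall>\<epsilon>>0. \<exists>q\<in>D. ?d p q < \<epsilon>)"
    then obtain D where D: "D \<subseteq> type_space L N n A" "countable D"
      and dense: "\<forall>p\<in>type_space L N n A. \<forall>\<epsilon>>0. \<exists>q\<in>D. ?d p q < \<epsilon>" by (elim exE conjE)
    \<comment> \<open>Balls of radius \<open>\<epsilon> / 2\<close> around different types \<open>g x\<close> are disjoint.\<close>
    have "\<exists>q\<in>D. ?d (g x) q < \<epsilon> / 2" for x
      using bspec[OF dense gA, rule_format, of "\<epsilon> / 2" x] \<epsilon> by simp
    then obtain h where h: "\<And>x. h x \<in> D" "\<And>x. ?d (g x) (h x) < \<epsilon> / 2" by metis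
    have "inj h"
    proof (rule injI, rule ccontr)
      fix x y assume eq: "h x = h y" and "x \<noteq> y"
      have hA: "h x \<in> type_space L N n A" using h(1) D(1) by auto
      have "?d (g x) (g y) \<le> ?d (g x) (h x) + ?d (h x) (g y)"
        by (rule A.type_dist_triangle[OF gA hA gA])
      also have "?d (h x) (g y) = ?d (g y) (h y)"
        using A.type_dist_commute[OF hA gA] eq by simp
      finally show False using far[OF \<open>x \<noteq> y\<close>] h(2)[of x] h(2)[of y] by linarith
    qed
    moreover have "countable (range h)" using h(1) D(2) by (meson countable_subset image_subset_iff)
    ultimately have "countable (UNIV :: nat set set)" using countable_image_inj_on by blast
    then show False using uncountable_nat_sets by blast
  qed
  with AB \<open>countable A\<close> show ?thesis by blast
qed

theorem corollary4p17:
  fixes L :: "('f, 'p) signature"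
    and T :: "('f, 'p, 'm) fml set"
    and \<kappa> :: "'k rel"
    and M N :: "('f, 'p, 'm) cstructure"
  assumes "continuous_signature L" and "countable_signature L"
    and "complete_theory L T"
    and "monster_model L T \<kappa> M"
    and "saturated_extension L M N"
  shows "aleph0_stable L M N \<longleftrightarrow>
    (\<forall>n X \<pi> \<epsilon>. type_definable L \<kappa> M n X \<pi> \<longrightarrow> X \<noteq> {} \<longrightarrow> \<epsilon> > 0 \<longrightarrow>
       (\<exists>\<alpha>. Morley_rank L M N n \<epsilon> \<pi> = Ordinal \<alpha>))"
proof
  have sat: "saturated_over L N A" if "A \<subseteq> univ M" for A
    using assms(5) that by (rule saturated_extension_over)
  {
    assume stable: "aleph0_stable L M N"
    show "\<forall>n X \<pi> \<epsilon>. type_definable L \<kappa> M n X \<pi> \<longrightarrow> X \<noteq> {} \<longrightarrow> \<epsilon> > 0 \<longrightarrow>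
       (\<exists>\<alpha>. Morley_rank L M N n \<epsilon> \<pi> = Ordinal \<alpha>)"
    proof (intro allI impI)
      fix n X \<pi> and \<epsilon> :: real assume "\<epsilon> > 0"
      have "Morley_rank L M N n \<epsilon> \<pi> \<noteq> Infinity"
      proof
        assume "Morley_rank L M N n \<epsilon> \<pi> = Infinity"
        then obtain P where "eps_perfect (logic_topology L N n (univ M)) (type_dist L N n (univ M)) \<epsilon> P" "P \<noteq> {}"
          unfolding Morley_rank_def CB_rank_Infinity_iff by blast
        from perfect_gives_not_separable[OF sat \<open>\<epsilon> > 0\<close> this] stable
        show False unfolding aleph0_stable_def by blast
      qed
      then show "\<exists>\<alpha>. Morley_rank L M N n \<epsilon> \<pi> = Ordinal \<alpha>"
        by (cases "Morley_rank L M N n \<epsilon> \<pi>") auto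
    qed
  }
  {
    assume ranks: "\<forall>n X \<pi> \<epsilon>. type_definable L \<kappa> M n X \<pi> \<longrightarrow> X \<noteq> {} \<longrightarrow> \<epsilon> > 0 \<longrightarrow>
       (\<exists>\<alpha>. Morley_rank L M N n \<epsilon> \<pi> = Ordinal \<alpha>)"
    show "aleph0_stable L M N"
    proof (rule ccontr)
      assume "\<not> aleph0_stable L M N"
      then obtain n A where A: "A \<subseteq> univ M" "countable A" and
        notsep: "\<nexists>D. D \<subseteq> type_space L N n A \<and> countable D \<and>
          (\<forall>p\<in>type_space L N n A. \<forall>\<epsilon>>0. \<exists>q\<in>D. type_dist L N n A p q < \<epsilon>)"
        unfolding aleph0_stable_def by blast
      obtain \<epsilon> P where \<epsilon>: "\<epsilon> > 0" and
        P: "eps_perfect (logic_topology L N n (univ M)) (type_dist L N n (univ M)) \<epsilon> P" "P \<noteq> {}"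
        using not_separable_gives_perfect[OF saturated_over.axioms(1)[OF sat[OF A(1)]]
            sat[OF order_refl] A(1) assms(2) A(2) notsep] by blast
      have "P \<subseteq> types_satisfying L M N n {}"
        using P(1) closedin_subset[of "logic_topology L N n (univ M)" P]
        by (simp add: eps_perfect_def types_satisfying_def topspace_logic_topology)
      then have "P \<inter> types_satisfying L M N n {} \<noteq> {}" using P(2) by blast
      then have "Morley_rank L M N n \<epsilon> {} = Infinity"
        unfolding Morley_rank_def CB_rank_Infinity_iff using P(1) by blast
      \<comment> \<open>The empty partial type defines the whole \<open>n\<close>-th power of \<open>M\<close>.\<close>
      moreover have "type_definable L \<kappa> M n (solutions M n {}) {}"
      proof -
        have "(card_of ({} :: 'm set), natLeq) \<in> ordLess" by (simp add: finite_iff_ordLess_natLeq[symmetric])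
        then have "small \<kappa> ({} :: 'm set)"
          using assms(4) unfolding small_def monster_model_def by (blast intro: ordLess_transitive)
        then show ?thesis unfolding type_definable_def by blast
      qed
      moreover have "solutions M n {} \<noteq> {}"
      proof -
        have "univ M \<noteq> {}"
          using assms(5) by (simp add: saturated_extension_def elementary_extension_def is_structure_def)
        then show ?thesis by (simp add: solutions_def PiE_eq_empty_iff)
      qed
      ultimately show False using ranks \<epsilon> by (metis rank.distinct(1))
    qed
  }
qed

end
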